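(* Let $R$ be a standard graded algebra over a field $k$ and let $M$ be a nonzero finitely generated graded $R$-module. If $\operatorname{ld}_R(M)=d<\infty$, then $$\operatorname{reg}_R(M)=\max\{t_i(M)-i:\ 0\le i\le d\}.$$ In particular, if $M$ is Koszul, then $\operatorname{reg}_R(M)=t_0(M)$.
   Context: A standard graded $k$-algebra is $R=\bigoplus_{i\ge0}R_i$ with $R_0=k$, generated as a $k$-algebra by finitely many elements of degree 1; $\mathfrak m=\bigoplus_{i\ge1}R_i$. The ring $R^g=\bigoplus_{p\ge0}\mathfrak m^p/\mathfrak m^{p+1}$ is identified with $R$. For a finitely generated graded $R$-module $M$, $\beta_{ij}^R(M)=\dim_k\operatorname{Tor}_i^R(M,k)_j$, $t_i(M)=\sup\{j:\beta_{ij}^R(M)\ne0\}$ (with $t_i(M)=-\infty$ if $\operatorname{Tor}_i^R(M,k)=0$), and $\operatorname{reg}_R(M)=\sup\{j-i:\beta_{ij}^R(M)\ne0\}=\sup_i\{t_i(M)-i\}$. Linear part and linearity defect: let $\mathbf F$ be a minimal graded free resolution of $M$ over $R$. The standard filtration of $\mathbf F$ consists of the subcomplexes $\mathfrak F^i\mathbf F$ with $(\mathfrak F^i\mathbf F)_n=\mathfrak m^{i-n}F_n$, where $\mathfrak m^j=R$ for $j\le0$. The associated graded complex of this filtration is denoted $\operatorname{lin}^R(\mathbf F)$; it is a complex of graded $R^g$-modules with $\operatorname{lin}^R(\mathbf F)_n=F_n^g(-n)$, where $F_n^g=\bigoplus_p\mathfrak m^pF_n/\mathfrak m^{p+1}F_n$.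 (Equivalently, $\operatorname{lin}^R(\mathbf F)$ is obtained from $\mathbf F$ by replacing by $0$ all entries of degree $>1$ in the matrices representing the differentials.) The linearity defect is $\operatorname{ld}_R(M)=\sup\{i:H_i(\operatorname{lin}^R(\mathbf F))\ne0\}$. $M$ is Koszul if $\operatorname{lin}^R(\mathbf F)$ is acyclic (homology only in degree 0), i.e. $\operatorname{ld}_R(M)=0$. *)

theory Defs
  imports
    Complex_Main
    "HOL-Library.Extended_Nat"
    "HOL-Library.Extended_Real"
    "HOL-Library.Function_Algebras"
begin

section \<open>Graded algebras and modules\<close>

text \<open>An internal direct sum decomposition of the whole (additive group) type.\<close>

definition is_grading :: "('i \<Rightarrow> 'a::ab_group_add set) \<Rightarrow> bool" where
  "is_grading G \<longleftrightarrow>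
     (\<forall>i. 0 \<in> G i \<and> (\<forall>x\<in>G i. - x \<in> G i) \<and> (\<forall>x\<in>G i. \<forall>y\<in>G i. x + y \<in> G i)) \<and>
     (\<forall>x. \<exists>!f. (\<forall>i. f i \<in> G i) \<and> finite {i. f i \<noteq> 0} \<and> x = (\<Sum>i | f i \<noteq> 0. f i))"

inductive_set generated_subalgebra :: "('k \<Rightarrow> 'r::comm_ring_1) \<Rightarrow> 'r set \<Rightarrow> 'r set"
  for \<kappa> :: "'k \<Rightarrow> 'r" and X :: "'r set" where
  scalar: "\<kappa> c \<in> generated_subalgebra \<kappa> X"
| gen: "x \<in> X \<Longrightarrow> x \<in> generated_subalgebra \<kappa> X"
| add: "a \<in> generated_subalgebra \<kappa> X \<Longrightarrow> b \<in> generated_subalgebra \<kappa> X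
         \<Longrightarrow> a + b \<in> generated_subalgebra \<kappa> X"
| mult: "a \<in> generated_subalgebra \<kappa> X \<Longrightarrow> b \<in> generated_subalgebra \<kappa> X
         \<Longrightarrow> a * b \<in> generated_subalgebra \<kappa> X"

text \<open>The ring \<open>R\<close> is the type \<open>'r\<close>, the structure map of the algebra is \<open>\<kappa>\<close>, and
  \<open>A i\<close> is the component of degree \<open>i\<close>. The map \<open>\<kappa>\<close> is automatically injective, so
  \<open>A 0 = range \<kappa>\<close> says that the degree 0 component is \<open>k\<close>.\<close>

locale standard_graded_algebra =
  fixes \<kappa> :: "'k::field \<Rightarrow> 'r::comm_ring_1" and A :: "nat \<Rightarrow> 'r set"
  assumes kappa_one: "\<kappa> 1 = 1"
    and kappa_add: "\<kappa> (x + y) = \<kappa> x + \<kappa> y"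
    and kappa_mult: "\<kappa> (x * y) = \<kappa> x * \<kappa> y"
    and grading: "is_grading A"
    and graded_mult: "a \<in> A i \<Longrightarrow> b \<in> A j \<Longrightarrow> a * b \<in> A (i + j)"
    and degree_zero: "A 0 = range \<kappa>"
    and generated: "\<exists>X. finite X \<and> X \<subseteq> A 1 \<and> generated_subalgebra \<kappa> X = UNIV"

locale fg_graded_module = standard_graded_algebra \<kappa> A + module smul
  for \<kappa> :: "'k::field \<Rightarrow> 'r::comm_ring_1" and A :: "nat \<Rightarrow> 'r set"
    and smul :: "'r \<Rightarrow> 'm::ab_group_add \<Rightarrow> 'm" +
  fixes N :: "int \<Rightarrow> 'm set"
  assumes module_grading: "is_grading N"
    and graded_smul: "a \<in> A i \<Longrightarrow> x \<in> N j \<Longrightarrow> smul a x \<in> N (int i + j)"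
    and finitely_generated: "\<exists>X. finite X \<and> module.span smul X = UNIV"

definition irrelevant_ideal :: "(nat \<Rightarrow> 'r::comm_ring_1 set) \<Rightarrow> 'r set" where
  "irrelevant_ideal A =
     {(\<Sum>i\<in>I. f i) | I f. finite I \<and> (\<forall>i\<in>I. 1 \<le> i \<and> f i \<in> A i)}"

primrec ideal_power :: "'r::comm_ring_1 set \<Rightarrow> nat \<Rightarrow> 'r set" where
  "ideal_power J 0 = UNIV"
| "ideal_power J (Suc p) = module.span (*) {a * b | a b. a \<in> J \<and> b \<in> ideal_power J p}"

definition degree_part :: "(nat \<Rightarrow> 'r::comm_ring_1 set) \<Rightarrow> int \<Rightarrow> 'r set" where
  "degree_part A j = (if j < 0 then {0} else A (nat j))"


section \<open>Graded free resolutions\<close>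

text \<open>The free module of rank \<open>r\<close> consists of the vectors \<open>nat \<Rightarrow> 'r\<close> supported on
  \<open>{..<r}\<close>; addition is the pointwise one of \<^theory>\<open>HOL-Library.Function_Algebras\<close>.\<close>

definition free_module :: "nat \<Rightarrow> (nat \<Rightarrow> 'r::comm_ring_1) set" where
  "free_module r = {v. \<forall>e\<ge>r. v e = 0}"

definition vscale :: "'r::comm_ring_1 \<Rightarrow> (nat \<Rightarrow> 'r) \<Rightarrow> nat \<Rightarrow> 'r" where
  "vscale a v = (\<lambda>e. a * v e)"

definition ideal_times :: "'r::comm_ring_1 set \<Rightarrow> (nat \<Rightarrow> 'r) set \<Rightarrow> (nat \<Rightarrow> 'r) set" where
  "ideal_times J V = module.span vscale {vscale a v | a v. a \<in> J \<and> v \<in> V}"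

text \<open>The data of a complex of finitely generated graded free modules augmented to a module:
  \<open>F\<^sub>n\<close> is the direct sum of the \<open>R(-shift F n e)\<close> for \<open>e < rank F n\<close>;
  \<open>mat F n i e\<close> is the coefficient of the basis element \<open>i\<close> of \<open>F\<^sub>n\<close> in the image of the basis
  element \<open>e\<close> of \<open>F\<^sub>n\<^sub>+\<^sub>1\<close>; and \<open>aug F e\<close> is the image in the module of the basis
  element \<open>e\<close> of \<open>F\<^sub>0\<close>.\<close>

record ('r, 'm) free_cpx =
  rank :: "nat \<Rightarrow> nat"
  shift :: "nat \<Rightarrow> nat \<Rightarrow> int"
  mat :: "nat \<Rightarrow> nat \<Rightarrow> nat \<Rightarrow> 'r"
  aug :: "nat \<Rightarrow> 'm"

definition chain :: "('r::comm_ring_1, 'm) free_cpx \<Rightarrow> nat \<Rightarrow> (nat \<Rightarrow> 'r) set" where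
  "chain F n = free_module (rank F n)"

text \<open>\<open>bd F n\<close> is the differential from \<open>F\<^sub>n\<close> to \<open>F\<^sub>n\<^sub>-\<^sub>1\<close>, with \<open>F\<^sub>-\<^sub>1 = 0\<close>.\<close>

fun bd :: "('r::comm_ring_1, 'm) free_cpx \<Rightarrow> nat \<Rightarrow> (nat \<Rightarrow> 'r) \<Rightarrow> nat \<Rightarrow> 'r" where
  "bd F 0 v = (\<lambda>i. 0)"
| "bd F (Suc n) v = (\<lambda>i. if i < rank F n then \<Sum>e<rank F (Suc n). mat F n i e * v e else 0)"

definition aug_map ::
  "('r::comm_ring_1 \<Rightarrow> 'm::ab_group_add \<Rightarrow> 'm) \<Rightarrow> ('r, 'm) free_cpx \<Rightarrow> (nat \<Rightarrow> 'r) \<Rightarrow> 'm" where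
  "aug_map smul F v = (\<Sum>e<rank F 0. smul (v e) (aug F e))"

definition graded_free_resolution ::
  "(nat \<Rightarrow> 'r::comm_ring_1 set) \<Rightarrow> ('r \<Rightarrow> 'm::ab_group_add \<Rightarrow> 'm) \<Rightarrow> (int \<Rightarrow> 'm set)
     \<Rightarrow> ('r, 'm) free_cpx \<Rightarrow> bool" where
  "graded_free_resolution A smul N F \<longleftrightarrow>
     (\<forall>n. \<forall>i<rank F n. \<forall>e<rank F (Suc n).
        mat F n i e \<in> degree_part A (shift F (Suc n) e - shift F n i)) \<and>
     (\<forall>e<rank F 0. aug F e \<in> N (shift F 0 e)) \<and>
     aug_map smul F ` chain F 0 = UNIV \<and>
     {v \<in> chain F 0. aug_map smul F v = 0} = bd F 1 ` chain F 1 \<and>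
     (\<forall>n\<ge>1. {v \<in> chain F n. bd F n v = 0} = bd F (Suc n) ` chain F (Suc n))"

definition minimal_graded_free_resolution ::
  "(nat \<Rightarrow> 'r::comm_ring_1 set) \<Rightarrow> ('r \<Rightarrow> 'm::ab_group_add \<Rightarrow> 'm) \<Rightarrow> (int \<Rightarrow> 'm set)
     \<Rightarrow> ('r, 'm) free_cpx \<Rightarrow> bool" where
  "minimal_graded_free_resolution A smul N F \<longleftrightarrow>
     graded_free_resolution A smul N F \<and>
     (\<forall>n. bd F (Suc n) ` chain F (Suc n) \<subseteq> ideal_times (irrelevant_ideal A) (chain F n))"


section \<open>Tor, Betti numbers and regularity\<close>

text \<open>The residue map from \<open>R\<close> to \<open>R/\<mm> = k\<close>.\<close>

definition residue :: "('k::field \<Rightarrow> 'r::comm_ring_1) \<Rightarrow> (nat \<Rightarrow> 'r set) \<Rightarrow> 'r \<Rightarrow> 'k" where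
  "residue \<kappa> A r = (THE c. r - \<kappa> c \<in> irrelevant_ideal A)"

text \<open>\<open>F\<^sub>n \<otimes>\<^sub>R k\<close> is the direct sum of the \<open>k(-shift F n e)\<close>, and the matrices of the
  differentials of \<open>F \<otimes>\<^sub>R k\<close> are those of \<open>F\<close> reduced modulo \<open>\<mm>\<close>.
  \<open>tensor_chain F n j\<close> is the component of degree \<open>j\<close> of \<open>F\<^sub>n \<otimes>\<^sub>R k\<close>.\<close>

definition tensor_chain :: "('r, 'm) free_cpx \<Rightarrow> nat \<Rightarrow> int \<Rightarrow> (nat \<Rightarrow> 'k::field) set" where
  "tensor_chain F n j = {v. \<forall>e. v e \<noteq> 0 \<longrightarrow> e < rank F n \<and> shift F n e = j}"

fun tensor_bd ::
  "('k::field \<Rightarrow> 'r::comm_ring_1) \<Rightarrow> (nat \<Rightarrow> 'r set) \<Rightarrow> ('r, 'm) free_cpx \<Rightarrow> nat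
     \<Rightarrow> (nat \<Rightarrow> 'k) \<Rightarrow> nat \<Rightarrow> 'k" where
  "tensor_bd \<kappa> A F 0 v = (\<lambda>i. 0)"
| "tensor_bd \<kappa> A F (Suc n) v =
     (\<lambda>i. if i < rank F n then \<Sum>e<rank F (Suc n). residue \<kappa> A (mat F n i e) * v e else 0)"

definition tor_cycles ::
  "('k::field \<Rightarrow> 'r::comm_ring_1) \<Rightarrow> (nat \<Rightarrow> 'r set) \<Rightarrow> ('r, 'm) free_cpx \<Rightarrow> nat \<Rightarrow> int
     \<Rightarrow> (nat \<Rightarrow> 'k) set" where
  "tor_cycles \<kappa> A F i j = {v \<in> tensor_chain F i j. tensor_bd \<kappa> A F i v = 0}"

definition tor_boundaries ::
  "('k::field \<Rightarrow> 'r::comm_ring_1) \<Rightarrow> (nat \<Rightarrow> 'r set) \<Rightarrow> ('r, 'm) free_cpx \<Rightarrow> nat \<Rightarrow> int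
     \<Rightarrow> (nat \<Rightarrow> 'k) set" where
  "tor_boundaries \<kappa> A F i j = tensor_bd \<kappa> A F (Suc i) ` tensor_chain F (Suc i) j"

text \<open>\<open>dim\<^sub>k Tor\<^sub>i(M,k)\<^sub>j\<close>, where Tor is the homology of \<open>F \<otimes>\<^sub>R k\<close> for a graded free
  resolution \<open>F\<close> of \<open>M\<close>, not required to be minimal; another choice of \<open>F\<close> gives an isomorphic
  graded vector space. The dimension of the quotient is a difference of dimensions because
  boundaries and cycles are nested finite-dimensional spaces.\<close>

definition betti ::
  "('k::field \<Rightarrow> 'r::comm_ring_1) \<Rightarrow> (nat \<Rightarrow> 'r set) \<Rightarrow> ('r \<Rightarrow> 'm::ab_group_add \<Rightarrow> 'm)
     \<Rightarrow> (int \<Rightarrow> 'm set) \<Rightarrow> nat \<Rightarrow> int \<Rightarrow> nat" where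
  "betti \<kappa> A smul N i j =
     (let F = (SOME F. graded_free_resolution A smul N F);
          dm = vector_space.dim (\<lambda>(c::'k) v e. c * v e)
      in dm (tor_cycles \<kappa> A F i j) - dm (tor_boundaries \<kappa> A F i j))"

text \<open>In \<^typ>\<open>ereal\<close> the supremum of the empty set is \<open>-\<infinity>\<close>, as wanted for a vanishing Tor.\<close>

definition t_deg ::
  "('k::field \<Rightarrow> 'r::comm_ring_1) \<Rightarrow> (nat \<Rightarrow> 'r set) \<Rightarrow> ('r \<Rightarrow> 'm::ab_group_add \<Rightarrow> 'm)
     \<Rightarrow> (int \<Rightarrow> 'm set) \<Rightarrow> nat \<Rightarrow> ereal" where
  "t_deg \<kappa> A smul N i = Sup {ereal (real_of_int j) | j. betti \<kappa> A smul N i j \<noteq> 0}"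

definition reg ::
  "('k::field \<Rightarrow> 'r::comm_ring_1) \<Rightarrow> (nat \<Rightarrow> 'r set) \<Rightarrow> ('r \<Rightarrow> 'm::ab_group_add \<Rightarrow> 'm)
     \<Rightarrow> (int \<Rightarrow> 'm set) \<Rightarrow> ereal" where
  "reg \<kappa> A smul N =
     Sup {ereal (real_of_int (j - int i)) | i j. betti \<kappa> A smul N i j \<noteq> 0}"


section \<open>Linear part and linearity defect\<close>

text \<open>\<open>filt A F p n\<close> is \<open>\<mm>\<^bsup>p-n\<^esup> F\<^sub>n\<close>, the degree \<open>n\<close> term of the \<open>p\<close>-th
  piece of the standard filtration; truncated subtraction on \<^typ>\<open>nat\<close> implements the convention
  \<open>\<mm>\<^bsup>j\<^esup> = R\<close> for \<open>j \<le> 0\<close>. For \<open>p \<le> 0\<close> the piece is all of \<open>F\<close>, so that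
  only natural \<open>p\<close> contribute to the associated graded complex.\<close>

definition filt ::
  "(nat \<Rightarrow> 'r::comm_ring_1 set) \<Rightarrow> ('r, 'm) free_cpx \<Rightarrow> nat \<Rightarrow> nat \<Rightarrow> (nat \<Rightarrow> 'r) set" where
  "filt A F p n = ideal_times (ideal_power (irrelevant_ideal A) (p - n)) (chain F n)"

text \<open>The \<open>p\<close>-th component of the associated graded complex: \<open>lin_chain A F p n\<close> is the set of
  cosets forming \<open>filt A F p n / filt A F (p+1) n\<close>, whose zero is \<open>filt A F (p+1) n\<close>, and
  \<open>lin_bd A F p n\<close> is the map induced by the differential of \<open>F\<close>. At \<open>n = 0\<close>, where \<open>bd F 0 = 0\<close>,
  \<open>n - 1\<close> is \<open>0\<close> and \<open>lin_bd A F p 0\<close> is the zero map.\<close>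

definition lin_chain ::
  "(nat \<Rightarrow> 'r::comm_ring_1 set) \<Rightarrow> ('r, 'm) free_cpx \<Rightarrow> nat \<Rightarrow> nat \<Rightarrow> (nat \<Rightarrow> 'r) set set" where
  "lin_chain A F p n = (\<lambda>v. (\<lambda>u. v + u) ` filt A F (Suc p) n) ` filt A F p n"

definition lin_bd ::
  "(nat \<Rightarrow> 'r::comm_ring_1 set) \<Rightarrow> ('r, 'm) free_cpx \<Rightarrow> nat \<Rightarrow> nat
     \<Rightarrow> (nat \<Rightarrow> 'r) set \<Rightarrow> (nat \<Rightarrow> 'r) set" where
  "lin_bd A F p n C = {bd F n v + u | v u. v \<in> C \<and> u \<in> filt A F (Suc p) (n - 1)}"

text \<open>\<open>H\<^sub>n(lin F) = 0\<close>: as \<open>lin F\<close> is the direct sum of its components, this means that every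
  component is exact at \<open>n\<close>.\<close>

definition lin_homology_zero ::
  "(nat \<Rightarrow> 'r::comm_ring_1 set) \<Rightarrow> ('r, 'm) free_cpx \<Rightarrow> nat \<Rightarrow> bool" where
  "lin_homology_zero A F n \<longleftrightarrow>
     (\<forall>p. {C \<in> lin_chain A F p n. lin_bd A F p n C = filt A F (Suc p) (n - 1)} =
          lin_bd A F p (Suc n) ` lin_chain A F p (Suc n))"

definition min_res ::
  "(nat \<Rightarrow> 'r::comm_ring_1 set) \<Rightarrow> ('r \<Rightarrow> 'm::ab_group_add \<Rightarrow> 'm) \<Rightarrow> (int \<Rightarrow> 'm set)
     \<Rightarrow> ('r, 'm) free_cpx" where
  "min_res A smul N = (SOME F. minimal_graded_free_resolution A smul N F)"

text \<open>For the zero module the supremum below is \<open>0\<close> rather than \<open>-\<infinity>\<close>; for a nonzero module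
  the set is nonempty, since then \<open>H\<^sub>0(lin F) \<noteq> 0\<close>.\<close>

definition linearity_defect ::
  "(nat \<Rightarrow> 'r::comm_ring_1 set) \<Rightarrow> ('r \<Rightarrow> 'm::ab_group_add \<Rightarrow> 'm) \<Rightarrow> (int \<Rightarrow> 'm set)
     \<Rightarrow> enat" where
  "linearity_defect A smul N =
     Sup {enat i | i. \<not> lin_homology_zero A (min_res A smul N) i}"

definition koszul ::
  "(nat \<Rightarrow> 'r::comm_ring_1 set) \<Rightarrow> ('r \<Rightarrow> 'm::ab_group_add \<Rightarrow> 'm) \<Rightarrow> (int \<Rightarrow> 'm set)
     \<Rightarrow> bool" where
  "koszul A smul N \<longleftrightarrow> (\<forall>i\<ge>1. lin_homology_zero A (min_res A smul N) i)"

end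

theory Submission
  imports Defs "HOL-Computational_Algebra.Polynomial"
begin

text \<open>Let \<open>F\<close> be the minimal resolution, so that \<open>t\<^sub>i(M)\<close> is the largest degree of a basis
  element of \<open>F\<^sub>i\<close>. If \<open>H\<^sub>n(lin F) = 0\<close> and \<open>n \<ge> 1\<close>, no basis element of \<open>F\<^sub>n\<close> is a cycle of \<open>lin F\<close>,
  because in its component nothing comes from \<open>F\<^sub>n\<^sub>+\<^sub>1\<close>. Its differential thus has an entry outside
  \<open>\<mm>\<^sup>2\<close>, which has degree 1 as \<open>R\<close> is generated in degree 1; so
  \<open>t\<^sub>n(M) - n \<le> t\<^sub>n\<^sub>-\<^sub>1(M) - (n - 1)\<close>. Betti numbers are computed from an arbitrary
  resolution, so one also needs the existence of minimal resolutions, via Hilbert's basis theorem,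
  and the comparison of two resolutions up to homotopy.\<close>

section \<open>Gradings and the irrelevant ideal\<close>

text \<open>The inequality holds at every \<open>n > d\<close>, so each value \<open>j - i\<close>
  attained beyond \<open>d\<close> can be traced down to homological degree \<open>d\<close> and is
  attained there; this is why the maximum stops at \<open>d\<close>. \<open>t_deg\<close> and
  \<open>reg\<close> only ask which Betti numbers are nonzero. Since \<open>betti\<close> is a
  difference of dimensions for an unspecified resolution, its vanishing is rephrased as
  \<open>tor_vanish\<close>, a statement about vectors over the ring modulo entries in
  \<open>\<mm>\<close>; in this form it passes through chain maps and a homotopy without any
  quotient space or isomorphism of Tor. Free modules have finite rank here, so every syzygy module
  must be finitely generated: this is what the basis theorem provides, proved by adjoining the
  generators of the algebra one at a time. Minimality needs no form of Nakayama's lemma: a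
  homogeneous generating set of least size has no relation with a coefficient outside
  \<open>\<mm>\<close>, because the degree 0 part of such a coefficient is an invertible
  scalar.\<close>

definition hcomp :: "('i \<Rightarrow> 'a::ab_group_add set) \<Rightarrow> 'a \<Rightarrow> 'i \<Rightarrow> 'a" where
  "hcomp G x = (THE f. (\<forall>i. f i \<in> G i) \<and> finite {i. f i \<noteq> 0} \<and> x = (\<Sum>i | f i \<noteq> 0. f i))"

context
  fixes G :: "'i \<Rightarrow> 'a::ab_group_add set"
  assumes G: "is_grading G"
begin

lemma grading_zero: "0 \<in> G i" and grading_add: "x \<in> G i \<Longrightarrow> y \<in> G i \<Longrightarrow> x + y \<in> G i"
  using G by (auto simp: is_grading_def)

lemma grading_sum: "(\<And>a. a \<in> I \<Longrightarrow> f a \<in> G i) \<Longrightarrow> sum f I \<in> G i"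
  by (induction I rule: infinite_finite_induct) (auto simp: grading_zero grading_add)

lemma hcomp_props:
  "(\<forall>i. hcomp G x i \<in> G i) \<and> finite {i. hcomp G x i \<noteq> 0} \<and>
   x = (\<Sum>i | hcomp G x i \<noteq> 0. hcomp G x i)"
proof -
  have "\<exists>!f. (\<forall>i. f i \<in> G i) \<and> finite {i. f i \<noteq> 0} \<and> x = (\<Sum>i | f i \<noteq> 0. f i)"
    using G by (simp add: is_grading_def)
  from theI'[OF this] show ?thesis unfolding hcomp_def .
qed

lemma hcomp_mem: "hcomp G x i \<in> G i"
  and hcomp_finite: "finite {i. hcomp G x i \<noteq> 0}"
  and hcomp_sum: "(\<Sum>i | hcomp G x i \<noteq> 0. hcomp G x i) = x"
  using hcomp_props[of x] by (blast, blast, metis)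

text \<open>\<open>I\<close> may be larger than the support of \<open>f\<close>: summands can
  cancel, so the exact support of a sum is not known in advance.\<close>

lemma hcomp_unique:
  assumes "\<And>i. f i \<in> G i" "finite I" "\<And>i. i \<notin> I \<Longrightarrow> f i = 0" "x = sum f I"
  shows "hcomp G x = f"
proof -
  have sub: "{i. f i \<noteq> 0} \<subseteq> I" using assms(3) by auto
  have "x = (\<Sum>i | f i \<noteq> 0. f i)"
    unfolding assms(4) using sub assms(2) by (intro sum.mono_neutral_right) auto
  moreover have "finite {i. f i \<noteq> 0}" using sub assms(2) finite_subset by blast
  moreover have "\<exists>!f. (\<forall>i. f i \<in> G i) \<and> finite {i. f i \<noteq> 0} \<and> x = (\<Sum>i | f i \<noteq> 0. f i)"
    using G by (simp add: is_grading_def)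
  ultimately show ?thesis using hcomp_props[of x] assms(1) by blast
qed

lemma hcomp_sum_superset:
  assumes "finite I" "{i. hcomp G x i \<noteq> 0} \<subseteq> I"
  shows "sum (hcomp G x) I = x"
proof -
  have "sum (hcomp G x) I = (\<Sum>i | hcomp G x i \<noteq> 0. hcomp G x i)"
    using assms by (intro sum.mono_neutral_right) auto
  then show ?thesis by (simp add: hcomp_sum)
qed

lemma hcomp_add: "hcomp G (x + y) i = hcomp G x i + hcomp G y i"
proof -
  let ?I = "{i. hcomp G x i \<noteq> 0} \<union> {i. hcomp G y i \<noteq> 0}"
  have "hcomp G (x + y) = (\<lambda>i. hcomp G x i + hcomp G y i)"
  proof (rule hcomp_unique[of _ ?I])
    show "x + y = (\<Sum>i\<in>?I. hcomp G x i + hcomp G y i)"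
      by (simp add: sum.distrib hcomp_sum_superset hcomp_finite)
  qed (auto simp: hcomp_mem hcomp_finite grading_add)
  then show ?thesis by simp
qed

lemma hcomp_of_mem: "x \<in> G i \<Longrightarrow> hcomp G x j = (if j = i then x else 0)"
  by (subst hcomp_unique[of "\<lambda>j. if j = i then x else 0" "{i}"]) (auto simp: grading_zero)

lemma hcomp_zero [simp]: "hcomp G 0 j = 0"
  using hcomp_add[of 0 0 j] by simp

lemma hcomp_minus: "hcomp G (- x) j = - hcomp G x j"
  using hcomp_add[of x "- x" j] by (simp add: add_eq_0_iff)

lemma hcomp_diff: "hcomp G (x - y) j = hcomp G x j - hcomp G y j"
  using hcomp_add[of x "- y" j] by (simp add: hcomp_minus)

lemma hcomp_of_sum: "hcomp G (sum f I) j = (\<Sum>a\<in>I. hcomp G (f a) j)"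
  by (induction I rule: infinite_finite_induct) (auto simp: hcomp_add)

end

section \<open>The grading indexed by the integers, and the irrelevant ideal\<close>

context standard_graded_algebra
begin

abbreviation \<mm> :: "'r set" where "\<mm> \<equiv> irrelevant_ideal A"
abbreviation D :: "int \<Rightarrow> 'r set" where "D \<equiv> degree_part A"

lemma degree_part_neg [simp]: "j < 0 \<Longrightarrow> D j = {0}"
  and degree_part_nonneg: "0 \<le> j \<Longrightarrow> D j = A (nat j)"
  by (auto simp: degree_part_def)

text \<open>Entries of vectors in shifted free modules have degrees such as \<open>j - s e\<close>,
  which can be negative. Extending the grading by zero to all integers avoids case distinctions
  later.\<close>

lemma int_grading: "is_grading D"
  unfolding is_grading_def
proof (intro conjI allI)
  fix i
  show "0 \<in> D i" "\<forall>x\<in>D i. - x \<in> D i" "\<forall>x\<in>D i. \<forall>y\<in>D i. x + y \<in> D i"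
    using grading by (auto simp: degree_part_def is_grading_def)
next
  fix x
  let ?f = "\<lambda>j. if j < 0 then 0 else hcomp A x (nat j)"
  have supp: "{j. ?f j \<noteq> 0} = int ` {i. hcomp A x i \<noteq> 0}"
    by (auto simp: image_iff split: if_splits) (metis nat_0_le not_less)
  show "\<exists>!f. (\<forall>i. f i \<in> D i) \<and> finite {i. f i \<noteq> 0} \<and> x = (\<Sum>i | f i \<noteq> 0. f i)"
  proof (rule ex1I[of _ ?f])
    have "(\<Sum>i | ?f i \<noteq> 0. ?f i) = x"
      unfolding supp by (subst sum.reindex) (auto simp: hcomp_sum[OF grading])
    then show "(\<forall>i. ?f i \<in> D i) \<and> finite {i. ?f i \<noteq> 0} \<and> x = (\<Sum>i | ?f i \<noteq> 0. ?f i)"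
      unfolding supp
      by (auto simp: degree_part_def hcomp_mem[OF grading] hcomp_finite[OF grading])
  next
    fix g assume g: "(\<forall>i. g i \<in> D i) \<and> finite {i. g i \<noteq> 0} \<and> x = (\<Sum>i | g i \<noteq> 0. g i)"
    have neg: "g j = 0" if "j < 0" for j using g that by (metis degree_part_neg singletonD)
    have supp: "{i. g i \<noteq> 0} = int ` {i. g (int i) \<noteq> 0}"
      using neg by (auto simp: image_iff) (metis nat_0_le not_less)
    have "finite {i. g (int i) \<noteq> 0}"
      using g unfolding supp by (simp add: finite_image_iff)
    moreover have "x = (\<Sum>i | g (int i) \<noteq> 0. g (int i))"
      using g unfolding supp by (simp add: sum.reindex)
    moreover have "g (int i) \<in> A i" for i
      using g[THEN conjunct1, rule_format, of "int i"] by (simp add: degree_part_def)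
    ultimately have "hcomp A x = (\<lambda>i. g (int i))"
      by (intro hcomp_unique[OF grading, of _ "{i. g (int i) \<noteq> 0}"]) auto
    then show "g = ?f" using neg by (auto simp: fun_eq_iff)
  qed
qed

lemmas deg_zero = grading_zero[OF int_grading] and deg_sum = grading_sum[OF int_grading]
  and hc_mem = hcomp_mem[OF int_grading] and hc_finite = hcomp_finite[OF int_grading]
  and hc_sum = hcomp_sum[OF int_grading] and hc_add = hcomp_add[OF int_grading]
  and hc_of_mem = hcomp_of_mem[OF int_grading] and hc_zero [simp] = hcomp_zero[OF int_grading]
  and hc_diff = hcomp_diff[OF int_grading]
  and hc_of_sum = hcomp_of_sum[OF int_grading]

lemma hc_neg [simp]: "j < 0 \<Longrightarrow> hcomp D a j = 0"
  using hc_mem[of a j] by simp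

lemma deg_mult: "a \<in> D i \<Longrightarrow> b \<in> D j \<Longrightarrow> a * b \<in> D (i + j)"
  using graded_mult[of a "nat i" b "nat j"] deg_zero[of "i + j"]
  by (cases "i < 0 \<or> j < 0") (auto simp: degree_part_nonneg nat_add_distrib)

text \<open>Scaling a homogeneous \<open>x\<close> of degree \<open>i\<close> shifts the
  decomposition of \<open>a\<close> by \<open>i\<close>, and decompositions are unique. The target
  is left general so as to cover both the ring and the module \<open>N\<close>.\<close>

lemma hcomp_scale_homogeneous:
  fixes H :: "int \<Rightarrow> 'b::ab_group_add set"
  assumes "module scale" "is_grading H"
    and gr: "\<And>a i x j. a \<in> D i \<Longrightarrow> x \<in> H j \<Longrightarrow> scale a x \<in> H (i + j)"
    and x: "x \<in> H i"
  shows "hcomp H (scale a x) j = scale (hcomp D a (j - i)) x"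
proof -
  interpret module scale by fact
  let ?I = "{i. hcomp D a i \<noteq> 0}"
  have "hcomp H (scale a x) = (\<lambda>j. scale (hcomp D a (j - i)) x)"
  proof (rule hcomp_unique[OF assms(2), of _ "(\<lambda>k. k + i) ` ?I"])
    fix j show "scale (hcomp D a (j - i)) x \<in> H j"
      using gr[OF hc_mem x, of a "j - i"] by simp
  next
    have "scale a x = (\<Sum>k\<in>?I. scale (hcomp D a k) x)"
      by (subst (1) hc_sum[of a, symmetric]) (simp add: scale_sum_left)
    then show "scale a x = (\<Sum>j\<in>(\<lambda>k. k + i) ` ?I. scale (hcomp D a (j - i)) x)"
      by (simp add: sum.reindex)
  next
    fix j assume "j \<notin> (\<lambda>k. k + i) ` ?I"
    then have "hcomp D a (j - i) = 0" by (metis (mono_tags, lifting) diff_add_cancel image_eqI mem_Collect_eq)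
    then show "scale (hcomp D a (j - i)) x = 0" by simp
  qed (simp add: hc_finite)
  then show ?thesis by simp
qed

lemma module_self: "module ((*) :: 'r \<Rightarrow> 'r \<Rightarrow> 'r)"
  by unfold_locales (auto simp: algebra_simps)

lemma hc_mult_homogeneous: "b \<in> D i \<Longrightarrow> hcomp D (a * b) j = hcomp D a (j - i) * b"
  by (rule hcomp_scale_homogeneous[OF module_self int_grading]) (rule deg_mult)

lemma hc_mult:
  "hcomp D (a * b) j = (\<Sum>i | hcomp D b i \<noteq> 0. hcomp D a (j - i) * hcomp D b i)"
  by (subst (1) hc_sum[of b, symmetric])
     (simp add: sum_distrib_left hc_of_sum hc_mult_homogeneous[OF hc_mem])

text \<open>Nonzero components of \<open>b\<close> have \<open>i \<ge> 0\<close>, and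
  \<open>i > 0\<close> makes the left factor a component of negative degree, hence zero. This is the
  multiplicativity behind the residue map.\<close>

lemma hc_mult_0: "hcomp D (a * b) 0 = hcomp D a 0 * hcomp D b 0"
proof -
  have "hcomp D (a * b) 0 = (\<Sum>i | hcomp D b i \<noteq> 0. if i = 0 then hcomp D a 0 * hcomp D b 0 else 0)"
    unfolding hc_mult
  proof (intro sum.cong refl)
    fix i assume "i \<in> {i. hcomp D b i \<noteq> 0}"
    then have "0 \<le> i" using hc_neg[of i b] by (metis (mono_tags) mem_Collect_eq not_less)
    then show "hcomp D a (0 - i) * hcomp D b i = (if i = 0 then hcomp D a 0 * hcomp D b 0 else 0)"
      by auto
  qed
  then show ?thesis by (simp add: sum.delta' hc_finite sum.delta)
qed

text \<open>As a linear condition on one component, membership in \<open>\<mm>\<close> gets all its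
  closure properties from those of \<open>hcomp\<close>.\<close>

lemma mem_irrelevant_iff: "x \<in> \<mm> \<longleftrightarrow> hcomp D x 0 = 0"
proof
  assume "x \<in> \<mm>"
  then obtain I f where *: "finite I" "\<forall>i\<in>I. 1 \<le> i \<and> f i \<in> A i" "x = (\<Sum>i\<in>I. f i)"
    by (auto simp: irrelevant_ideal_def)
  have "hcomp D (f i) 0 = 0" if "i \<in> I" for i
    using * that hc_of_mem[of "f i" "int i" 0] by (auto simp: degree_part_def)
  then show "hcomp D x 0 = 0" using * by (simp add: hc_of_sum)
next
  assume 0: "hcomp D x 0 = 0"
  have pos: "1 \<le> j" if "hcomp D x j \<noteq> 0" for j
    using that 0 hc_neg[of j x] by (metis int_one_le_iff_zero_less linorder_cases)
  let ?I = "{j. hcomp D x j \<noteq> 0}"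
  have int_nat: "int (nat j) = j" if "j \<in> ?I" for j using pos[of j] that by auto
  then have inj: "inj_on nat ?I" by (metis inj_on_inverseI)
  have "(\<Sum>i\<in>nat ` ?I. hcomp D x (int i)) = (\<Sum>j\<in>?I. hcomp D x j)"
    unfolding sum.reindex[OF inj] by (intro sum.cong refl) (use int_nat in \<open>simp del: int_nat_eq\<close>)
  then have "x = (\<Sum>i\<in>nat ` ?I. hcomp D x (int i))" by (simp only: hc_sum)
  moreover have "\<forall>i\<in>nat ` ?I. 1 \<le> i \<and> hcomp D x (int i) \<in> A i"
  proof
    fix i assume "i \<in> nat ` ?I"
    then have "1 \<le> i" using pos by fastforce
    then show "1 \<le> i \<and> hcomp D x (int i) \<in> A i"
      using hc_mem[of x "int i"] by (simp add: degree_part_def)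
  qed
  moreover have "finite (nat ` ?I)" using hc_finite by simp
  ultimately show "x \<in> \<mm>" unfolding irrelevant_ideal_def by blast
qed

lemma irrelevant_0: "0 \<in> \<mm>"
  and irrelevant_add: "x \<in> \<mm> \<Longrightarrow> y \<in> \<mm> \<Longrightarrow> x + y \<in> \<mm>"
  and irrelevant_mult_left: "x \<in> \<mm> \<Longrightarrow> a * x \<in> \<mm>"
  and irrelevant_mult_right: "x \<in> \<mm> \<Longrightarrow> x * a \<in> \<mm>"
  by (auto simp: mem_irrelevant_iff hc_add hc_diff hc_mult_0)

lemma irrelevant_sum: "(\<And>i. i \<in> I \<Longrightarrow> f i \<in> \<mm>) \<Longrightarrow> sum f I \<in> \<mm>"
  by (auto simp: mem_irrelevant_iff hc_of_sum)

lemma irrelevant_of_degree: "x \<in> D i \<Longrightarrow> i \<noteq> 0 \<Longrightarrow> x \<in> \<mm>"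
  by (auto simp: mem_irrelevant_iff hc_of_mem)

section \<open>The structure map and the residue map\<close>

lemma kappa_0: "\<kappa> 0 = 0"
  using kappa_add[of 0 0] by simp

lemma kappa_minus: "\<kappa> (- x) = - \<kappa> x"
  using kappa_add[of x "- x"] by (simp add: kappa_0 add_eq_0_iff)

lemma kappa_eq_0_iff: "\<kappa> x = 0 \<longleftrightarrow> x = 0"
proof
  assume "\<kappa> x = 0"
  show "x = 0"
  proof (rule ccontr)
    assume "x \<noteq> 0"
    then have "1 = \<kappa> (inverse x * x)" by (simp add: kappa_one)
    with \<open>\<kappa> x = 0\<close> show False by (simp add: kappa_mult)
  qed
qed (simp add: kappa_0)

lemma kappa_inject: "\<kappa> x = \<kappa> y \<longleftrightarrow> x = y"
  using kappa_eq_0_iff[of "x - y"] kappa_add[of x "- y"] by (simp add: kappa_minus)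

lemma kappa_sum: "\<kappa> (sum f I) = (\<Sum>i\<in>I. \<kappa> (f i))"
  by (induction I rule: infinite_finite_induct) (auto simp: kappa_0 kappa_add)

lemma kappa_degree: "\<kappa> c \<in> D 0"
  using degree_zero by (simp add: degree_part_def)

text \<open>The description in \<open>residue\<close> is unambiguous because the degree 0 part of
  \<open>x\<close> is \<open>\<kappa> c\<close> for a unique \<open>c\<close>. As \<kappa> is
  injective, \<open>residue\<close> inherits additivity and multiplicativity from the degree 0
  component.\<close>

lemma kappa_residue: "\<kappa> (residue \<kappa> A x) = hcomp D x 0"
proof -
  have "hcomp D x 0 \<in> range \<kappa>" using hc_mem[of x 0] degree_zero by (simp add: degree_part_def)
  then obtain c where c: "hcomp D x 0 = \<kappa> c" by auto
  have "x - \<kappa> c' \<in> \<mm> \<longleftrightarrow> c' = c" for c'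
    using kappa_inject[of c c'] hc_of_mem[OF kappa_degree, of c' 0]
    by (auto simp: mem_irrelevant_iff hc_diff c)
  then have "residue \<kappa> A x = c" unfolding residue_def by simp
  then show ?thesis by (simp add: c)
qed

lemma residue_eq_0_iff: "residue \<kappa> A x = 0 \<longleftrightarrow> x \<in> \<mm>"
  by (metis kappa_eq_0_iff kappa_residue mem_irrelevant_iff)

lemma residue_add: "residue \<kappa> A (x + y) = residue \<kappa> A x + residue \<kappa> A y"
  by (simp flip: kappa_inject add: kappa_add kappa_residue hc_add)

lemma residue_mult: "residue \<kappa> A (x * y) = residue \<kappa> A x * residue \<kappa> A y"
  by (simp flip: kappa_inject add: kappa_mult kappa_residue hc_mult_0)

lemma residue_diff: "residue \<kappa> A (x - y) = residue \<kappa> A x - residue \<kappa> A y"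
  using residue_add[of "x - y" y] by (simp add: algebra_simps)

lemma residue_kappa: "residue \<kappa> A (\<kappa> c) = c"
  by (simp flip: kappa_inject add: kappa_residue hc_of_mem[OF kappa_degree])

lemma residue_sum: "residue \<kappa> A (sum f I) = (\<Sum>i\<in>I. residue \<kappa> A (f i))"
  by (simp flip: kappa_inject add: kappa_sum kappa_residue hc_of_sum)

lemma one_not_irrelevant: "1 \<notin> \<mm>"
  using residue_kappa[of 1] residue_eq_0_iff[of 1] by (simp add: kappa_one)

lemma one_degree: "1 \<in> D 0"
  using kappa_degree[of 1] by (simp add: kappa_one)

section \<open>Powers of the irrelevant ideal\<close>

abbreviation ring_ideal :: "'r set \<Rightarrow> bool" where
  "ring_ideal J \<equiv> module.subspace (*) J"

lemma ring_ideal_iff: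
  "ring_ideal J \<longleftrightarrow> 0 \<in> J \<and> (\<forall>x\<in>J. \<forall>y\<in>J. x + y \<in> J) \<and> (\<forall>a. \<forall>x\<in>J. a * x \<in> J)"
  unfolding module.subspace_def[OF module_self] by (rule refl)

lemma ring_ideal_irrelevant: "ring_ideal \<mm>"
  by (simp add: ring_ideal_iff irrelevant_0 irrelevant_add irrelevant_mult_left)

lemma ring_ideal_power: "ring_ideal (ideal_power J p)"
proof (cases p)
  case 0
  then show ?thesis by (simp add: ring_ideal_iff)
qed (simp add: module.subspace_span[OF module_self])

lemma ideal_power_1: "ideal_power \<mm> 1 = \<mm>"
proof -
  have "{a * b | a b. a \<in> \<mm> \<and> b \<in> UNIV} = \<mm>"
  proof
    show "{a * b | a b. a \<in> \<mm> \<and> b \<in> UNIV} \<subseteq> \<mm>" using irrelevant_mult_right by auto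
    show "\<mm> \<subseteq> {a * b | a b. a \<in> \<mm> \<and> b \<in> UNIV}"
    proof
      fix x assume "x \<in> \<mm>"
      then have "x = x * 1 \<and> x \<in> \<mm> \<and> 1 \<in> UNIV" by simp
      then show "x \<in> {a * b | a b. a \<in> \<mm> \<and> b \<in> UNIV}" by blast
    qed
  qed
  then show ?thesis
    using module.span_eq_iff[OF module_self, THEN iffD2, OF ring_ideal_irrelevant] by simp
qed

lemma mult_mem_ideal_power_2: "a \<in> \<mm> \<Longrightarrow> b \<in> \<mm> \<Longrightarrow> a * b \<in> ideal_power \<mm> 2"
  unfolding Suc_1[symmetric] ideal_power.simps(2)[of _ 1] ideal_power_1
  by (rule module.span_base[OF module_self]) blast

text \<open>Since \<open>R\<close> is generated in degree 1, elements of degree at least 2 have order at least 2.\<close>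

lemma hc_mem_ideal_power_2:
  assumes "2 \<le> j"
  shows "hcomp D a j \<in> ideal_power \<mm> 2"
proof -
  let ?I = "ideal_power \<mm> 2"
  have I: "0 \<in> ?I" "x \<in> ?I \<Longrightarrow> y \<in> ?I \<Longrightarrow> x + y \<in> ?I" "x \<in> ?I \<Longrightarrow> b * x \<in> ?I" for x y b
    using ring_ideal_power[of \<mm> 2] by (auto simp: ring_ideal_iff)
  obtain X where X: "X \<subseteq> A 1" "generated_subalgebra \<kappa> X = UNIV" using generated by auto
  have "a \<in> generated_subalgebra \<kappa> X" using X by simp
  then have "\<forall>j\<ge>2. hcomp D a j \<in> ?I"
  proof induction
    case (scalar c)
    then show ?case using hc_of_mem[OF kappa_degree, of c] I(1) by auto
  next
    case (gen x)
    then have "x \<in> D 1" using X by (auto simp: degree_part_def)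
    then show ?case using hc_of_mem I(1) by auto
  next
    case (add a b)
    then show ?case by (auto simp: hc_add I)
  next
    case (mult a b)
    show ?case
    proof (intro allI impI)
      fix j :: int assume j: "2 \<le> j"
      show "hcomp D (a * b) j \<in> ?I"
        unfolding hc_mult
      proof (rule module.subspace_sum[OF module_self ring_ideal_power])
        fix i
        \<comment> \<open>Outside \<open>0..j\<close> one factor is zero; at the two ends one factor
          has degree \<open>j \<ge> 2\<close> and the induction hypothesis applies; strictly
          between, both factors have positive degree and their product is in the square.\<close>
        consider "i < 0" | "i = 0" | "0 < i" "i < j" | "i = j" | "i > j" by linarith
        then show "hcomp D a (j - i) * hcomp D b i \<in> ?I"
        proof cases
          case 2
          then show ?thesis using mult.IH(1) j I(3) by (simp add: mult.commute)
        next
          case 3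
          then show ?thesis
            by (intro mult_mem_ideal_power_2 irrelevant_of_degree[OF hc_mem]) auto
        next
          case 4
          then show ?thesis using mult.IH(2) j I(3) by simp
        qed (simp_all add: I(1))
      qed
    qed
  qed
  then show ?thesis using assms by simp
qed

lemma degree_ge_2_mem: "x \<in> D j \<Longrightarrow> 2 \<le> j \<Longrightarrow> x \<in> ideal_power \<mm> 2"
  using hc_mem_ideal_power_2[of j x] hc_of_mem[of x j j] by simp

end

section \<open>Hilbert's basis theorem\<close>

text \<open>Coefficients come from a subset \<open>S\<close> of the ring because the intermediate
  rings of the induction are subrings, not types.\<close>

inductive_set span_over :: "'r::comm_ring_1 set \<Rightarrow> 'r set \<Rightarrow> 'r set" for S B where
  zero: "0 \<in> span_over S B"
| step: "s \<in> S \<Longrightarrow> b \<in> B \<Longrightarrow> y \<in> span_over S B \<Longrightarrow> s * b + y \<in> span_over S B"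

definition subring_of :: "'r::comm_ring_1 set \<Rightarrow> bool" where
  "subring_of S \<longleftrightarrow> 1 \<in> S \<and> (\<forall>x\<in>S. \<forall>y\<in>S. x - y \<in> S \<and> x * y \<in> S)"

text \<open>The ascending chain condition, phrased for sequences: some member lies in the ideal
  generated by its predecessors. Hilbert's argument uses exactly this for a sequence of leading
  coefficients.\<close>

definition noetherian_ring_on :: "'r::comm_ring_1 set \<Rightarrow> bool" where
  "noetherian_ring_on S \<longleftrightarrow>
     (\<forall>x :: nat \<Rightarrow> 'r. range x \<subseteq> S \<longrightarrow> (\<exists>n. x n \<in> span_over S (x ` {..<n})))"

lemma subring_of_0: "subring_of S \<Longrightarrow> 0 \<in> S"
  and subring_of_1: "subring_of S \<Longrightarrow> 1 \<in> S"
  and subring_of_diff: "subring_of S \<Longrightarrow> x \<in> S \<Longrightarrow> y \<in> S \<Longrightarrow> x - y \<in> S"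
  and subring_of_mult: "subring_of S \<Longrightarrow> x \<in> S \<Longrightarrow> y \<in> S \<Longrightarrow> x * y \<in> S"
  unfolding subring_of_def by (metis cancel_comm_monoid_add_class.diff_cancel, blast+)

lemma subring_of_minus: "subring_of S \<Longrightarrow> x \<in> S \<Longrightarrow> - x \<in> S"
  using subring_of_diff[of S 0 x] subring_of_0[of S] by simp

lemma subring_of_add: "subring_of S \<Longrightarrow> x \<in> S \<Longrightarrow> y \<in> S \<Longrightarrow> x + y \<in> S"
  using subring_of_diff[of S x "- y"] subring_of_minus[of S y] by simp

lemma span_over_base: "subring_of S \<Longrightarrow> b \<in> B \<Longrightarrow> b \<in> span_over S B"
  using span_over.step[OF subring_of_1 _ span_over.zero, of S b B] by simp

lemma span_over_add: "x \<in> span_over S B \<Longrightarrow> y \<in> span_over S B \<Longrightarrow> x + y \<in> span_over S B"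
  by (induction rule: span_over.induct) (auto simp: add.assoc intro: span_over.step)

lemma span_over_scale:
  "x \<in> span_over S B \<Longrightarrow> subring_of S \<Longrightarrow> a \<in> S \<Longrightarrow> a * x \<in> span_over S B"
proof (induction rule: span_over.induct)
  case (step s b y)
  then show ?case
    using span_over.step[of "a * s" S b B "a * y"]
    by (simp add: subring_of_mult distrib_left mult.assoc)
qed (simp add: span_over.zero)

lemma span_over_trans:
  "x \<in> span_over S B \<Longrightarrow> B \<subseteq> span_over S C \<Longrightarrow> subring_of S \<Longrightarrow> x \<in> span_over S C"
  by (induction rule: span_over.induct)
     (auto intro: span_over.zero intro!: span_over_add span_over_scale)

lemma span_over_mono: "B \<subseteq> C \<Longrightarrow> subring_of S \<Longrightarrow> span_over S B \<subseteq> span_over S C"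
  using span_over_trans span_over_base by blast

text \<open>The spans of the prefixes increase, so finitely many members of their union lie in a
  single one.\<close>

lemma span_over_prefix:
  assumes S: "subring_of S" and "finite B" "B \<subseteq> (\<Union>n. span_over S (x ` {..<n}))"
  shows "\<exists>n. B \<subseteq> span_over S (x ` {..<n::nat})"
  using assms(2,3)
proof (induction B rule: finite_induct)
  case (insert b B)
  then obtain n m where "B \<subseteq> span_over S (x ` {..<n})" "b \<in> span_over S (x ` {..<m})" by auto
  moreover have "span_over S (x ` {..<n}) \<subseteq> span_over S (x ` {..<max n m})"
    "span_over S (x ` {..<m}) \<subseteq> span_over S (x ` {..<max n m})"
    by (rule span_over_mono[OF _ S]; auto)+
  ultimately have "insert b B \<subseteq> span_over S (x ` {..<max n m})" by blast
  then show ?case by blast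
qed auto

text \<open>In a field the index is 0 or 1: either \<open>x 0\<close> is zero, or it is a unit and
  divides \<open>x 1\<close>.\<close>

lemma noetherian_ring_on_range_field:
  fixes \<kappa> :: "'k::field \<Rightarrow> 'r::comm_ring_1"
  assumes one: "\<kappa> 1 = 1" and mult: "\<And>x y. \<kappa> (x * y) = \<kappa> x * \<kappa> y" and "\<kappa> 0 = 0"
  shows "noetherian_ring_on (range \<kappa>)"
  unfolding noetherian_ring_on_def
proof (intro allI impI)
  fix x :: "nat \<Rightarrow> 'r" assume x: "range x \<subseteq> range \<kappa>"
  obtain c d where c: "x 0 = \<kappa> c" and d: "x 1 = \<kappa> d" using x by blast
  show "\<exists>n. x n \<in> span_over (range \<kappa>) (x ` {..<n})"
  proof (cases "c = 0")
    case True
    then have "x 0 = 0" using c assms by simp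
    then show ?thesis using span_over.zero by metis
  next
    case False
    then have "x 1 = \<kappa> (d / c) * x 0 + 0" unfolding c d mult[symmetric] by simp
    moreover have "\<kappa> (d / c) * x 0 + 0 \<in> span_over (range \<kappa>) (x ` {..<1})"
      by (intro span_over.step span_over.zero) auto
    ultimately show ?thesis by metis
  qed
qed

text \<open>The element \<open>t\<close> may satisfy relations over \<open>S\<close>, so an ideal of \<open>S[t]\<close> is studied through the
  polynomials over \<open>S\<close> whose value at \<open>t\<close> lies in it.\<close>

definition adjoin :: "'r::comm_ring_1 set \<Rightarrow> 'r \<Rightarrow> 'r set" where
  "adjoin S t = {poly p t | p. \<forall>i. coeff p i \<in> S}"

lemma adjoin_superset:
  assumes "subring_of S"
  shows "insert t S \<subseteq> adjoin S t"
proof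
  fix s assume s: "s \<in> insert t S"
  have "\<exists>p. poly p t = s \<and> (\<forall>i. coeff p i \<in> S)"
  proof (cases "s = t")
    case True
    then show ?thesis using assms
      by (intro exI[of _ "[:0, 1:]"])
         (auto simp: coeff_pCons split: nat.splits intro: subring_of_0 subring_of_1)
  next
    case False
    then show ?thesis using assms s
      by (intro exI[of _ "[:s:]"]) (auto simp: coeff_pCons split: nat.splits intro: subring_of_0)
  qed
  then show "s \<in> adjoin S t" by (auto simp: adjoin_def)
qed

lemma coeff_mult_mem:
  assumes "subring_of S" "\<forall>i. coeff p i \<in> S" "\<forall>i. coeff q i \<in> S"
  shows "coeff (p * q) i \<in> S"
proof -
  have "(\<Sum>j\<in>I. coeff p j * coeff q (i - j)) \<in> S" for I
    using assms by (induction I rule: infinite_finite_induct)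
      (auto intro: subring_of_0 subring_of_add subring_of_mult)
  then show ?thesis by (simp add: coeff_mult)
qed

lemma subring_of_adjoin:
  assumes "subring_of S"
  shows "subring_of (adjoin S t)"
  unfolding subring_of_def
proof (intro conjI ballI)
  show "1 \<in> adjoin S t" using adjoin_superset[OF assms] subring_of_1[OF assms] by blast
next
  fix x y assume "x \<in> adjoin S t" "y \<in> adjoin S t"
  then obtain p q where pq: "x = poly p t" "y = poly q t" "\<forall>i. coeff p i \<in> S" "\<forall>i. coeff q i \<in> S"
    by (auto simp: adjoin_def)
  have "x - y = poly (p - q) t" "x * y = poly (p * q) t" using pq by auto
  moreover have "\<forall>i. coeff (p - q) i \<in> S" "\<forall>i. coeff (p * q) i \<in> S"
    using pq assms by (auto intro: subring_of_diff coeff_mult_mem)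
  ultimately show "x - y \<in> adjoin S t" "x * y \<in> adjoin S t" unfolding adjoin_def by blast+
qed

text \<open>Hilbert's argument: pick polynomials \<open>f n\<close> of least degree whose values at
  \<open>t\<close> lie in the ideal \<open>I\<close> but outside the span of the earlier values.
  Some leading coefficient is a combination of earlier ones, and cancelling it contradicts the
  choice of least degree.\<close>

lemma noetherian_ring_on_adjoin:
  fixes S :: "'r::comm_ring_1 set"
  assumes S: "subring_of S" and noeth: "noetherian_ring_on S"
  shows "noetherian_ring_on (adjoin S t)"
  unfolding noetherian_ring_on_def
proof (intro allI impI, rule ccontr)
  let ?T = "adjoin S t"
  note T = subring_of_adjoin[OF S, of t]
  fix y :: "nat \<Rightarrow> 'r" assume y: "range y \<subseteq> ?T" and "\<nexists>n. y n \<in> span_over ?T (y ` {..<n})"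
  then have notin: "y n \<notin> span_over ?T (y ` {..<n})" for n by blast
  define I where "I = (\<Union>n. span_over ?T (y ` {..<n}))"
  define P where "P B p \<longleftrightarrow> (\<forall>i. coeff p i \<in> S) \<and> poly p t \<in> I - span_over ?T B" for B p
  have y_I: "y n \<in> I" for n
    using span_over_base[OF T, of "y n" "y ` {..<Suc n}"] by (auto simp: I_def)
  have I_add: "u + v \<in> I" if uv: "u \<in> I" "v \<in> I" for u v
  proof -
    obtain n where "{u, v} \<subseteq> span_over ?T (y ` {..<n})"
      using span_over_prefix[OF T, of "{u, v}" y] uv by (auto simp: I_def)
    then show ?thesis by (auto simp: I_def intro: span_over_add)
  qed
  have I_0: "0 \<in> I" by (auto simp: I_def intro: span_over.zero)
  have I_scale: "a * u \<in> I" if "a \<in> ?T" "u \<in> I" for a u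
    using that span_over_scale[OF _ T] by (auto simp: I_def)
  \<comment> \<open>No finite \<open>B\<close> generates \<open>I\<close>: it would lie in the span
    of a prefix of \<open>y\<close>, and the next member of \<open>y\<close> is outside that
    span.\<close>
  have ex: "\<exists>p. P B p" if B: "finite B" "B \<subseteq> I" for B
  proof -
    obtain n where "B \<subseteq> span_over ?T (y ` {..<n})"
      using span_over_prefix[OF T, of B y] B by (auto simp: I_def)
    then have "y n \<notin> span_over ?T B" using notin span_over_trans[OF _ _ T] by blast
    moreover obtain p where "y n = poly p t" "\<forall>i. coeff p i \<in> S"
      using y by (auto simp: adjoin_def)
    ultimately show ?thesis using y_I[of n] by (auto simp: P_def intro!: exI[of _ p])
  qed
  define Q where "Q f n g \<longleftrightarrow> is_arg_min degree (P ((\<lambda>i. poly (f i) t) ` {..<n})) g"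
    for f :: "nat \<Rightarrow> 'r poly" and n :: nat and g
  have "\<exists>f. \<forall>n. Q f n (f n)"
  proof (rule dependent_wellorder_choice)
    fix f g :: "nat \<Rightarrow> 'r poly" and n :: nat and p
    assume "\<And>m. m < n \<Longrightarrow> f m = g m"
    then have "(\<lambda>i. poly (f i) t) ` {..<n} = (\<lambda>i. poly (g i) t) ` {..<n}" by (auto simp: image_iff)
    then show "Q f n p = Q g n p" by (simp add: Q_def)
  next
    fix n f assume f: "\<And>m. m < n \<Longrightarrow> Q f m (f m)"
    have "poly (f m) t \<in> I" if "m < n" for m
      using f[of m] that by (auto simp: Q_def P_def is_arg_min_def)
    then have "\<exists>p. P ((\<lambda>i. poly (f i) t) ` {..<n}) p" by (intro ex) auto
    then obtain p where "P ((\<lambda>i. poly (f i) t) ` {..<n}) p" by blast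
    then show "\<exists>p. Q f n p" unfolding Q_def by (blast intro: is_arg_min_arg_min_nat)
  qed
  then obtain f where "\<And>n. Q f n (f n)" by auto
  then have f: "P ((\<lambda>i. poly (f i) t) ` {..<n}) (f n)"
    "P ((\<lambda>i. poly (f i) t) ` {..<n}) p \<Longrightarrow> degree (f n) \<le> degree p" for n p
    unfolding Q_def is_arg_min_def by (auto simp: not_less)
  have f_S: "coeff (f n) i \<in> S" for n i using f(1) by (auto simp: P_def)
  \<comment> \<open>\<open>f n\<close> was already a candidate when \<open>f i\<close> was chosen.
    Hence the exponent \<open>?d - degree (f i)\<close> used below is a genuine difference.\<close>
  have deg_mono: "degree (f i) \<le> degree (f n)" if "i < n" for i n
  proof (rule f(2))
    have "span_over ?T ((\<lambda>i. poly (f i) t) ` {..<i}) \<subseteq> span_over ?T ((\<lambda>i. poly (f i) t) ` {..<n})"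
      using that by (intro span_over_mono[OF _ T]) auto
    then show "P ((\<lambda>i. poly (f i) t) ` {..<i}) (f n)" using f(1)[of n] by (auto simp: P_def)
  qed
  obtain n where n: "lead_coeff (f n) \<in> span_over S ((\<lambda>i. lead_coeff (f i)) ` {..<n})"
    using noeth f_S unfolding noetherian_ring_on_def by fast
  let ?d = "degree (f n)" and ?B = "(\<lambda>i. poly (f i) t) ` {..<n}"
  \<comment> \<open>Each combination of earlier leading coefficients is realised as the coefficient
    at \<open>?d\<close> of a polynomial with value in the span, by raising every \<open>f i\<close>
    to degree \<open>?d\<close> with a monomial.\<close>
  have "\<exists>q. (\<forall>i. coeff q i \<in> S) \<and> degree q \<le> ?d \<and> coeff q ?d = c \<and> poly q t \<in> span_over ?T ?B"
    if "c \<in> span_over S ((\<lambda>i. lead_coeff (f i)) ` {..<n})" for c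
    using that
  proof induction
    case zero
    show ?case using subring_of_0[OF S] by (intro exI[of _ 0]) (auto intro: span_over.zero)
  next
    case (step s b c)
    then obtain q i where q: "\<forall>i. coeff q i \<in> S" "degree q \<le> ?d" "coeff q ?d = c"
      "poly q t \<in> span_over ?T ?B" and i: "i < n" "b = lead_coeff (f i)" by auto
    let ?m = "monom s (?d - degree (f i))"
    have m: "\<forall>i. coeff ?m i \<in> S" using step.hyps subring_of_0[OF S] by auto
    have "degree (?m * f i) \<le> ?d"
      using degree_mult_le[of ?m "f i"] degree_monom_le[of s "?d - degree (f i)"] deg_mono[OF i(1)]
      by linarith
    then have "degree (?m * f i + q) \<le> ?d" using q(2) by (rule degree_add_le)
    moreover have "coeff (?m * f i + q) ?d = s * b + c"
      using deg_mono[OF i(1)] q(3) by (simp add: coeff_monom_mult i(2))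
    moreover have "\<forall>j. coeff (?m * f i + q) j \<in> S"
      using coeff_mult_mem[OF S m] f_S q(1) by (auto intro: subring_of_add[OF S])
    moreover have "poly ?m t \<in> ?T" unfolding adjoin_def using m by blast
    then have "poly (?m * f i + q) t \<in> span_over ?T ?B"
      using q(4) i(1) by (simp only: poly_add poly_mult) (intro span_over.step, auto)
    ultimately show ?case by blast
  qed
  from this[OF n] obtain q where q: "\<forall>i. coeff q i \<in> S" "degree q \<le> ?d" "coeff q ?d = lead_coeff (f n)"
    "poly q t \<in> span_over ?T ?B" by blast
  have B_I: "?B \<subseteq> I" using f(1) by (auto simp: P_def)
  have span_I: "u \<in> I" if "u \<in> span_over ?T ?B" for u
    using that by induction (use B_I in \<open>auto intro: I_0 intro!: I_add I_scale\<close>)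
  have m1: "- 1 \<in> ?T" using subring_of_minus[OF T subring_of_1[OF T]] .
  have Pq: "P ?B (f n - q)"
    unfolding P_def
  proof (intro conjI allI DiffI)
    show "coeff (f n - q) i \<in> S" for i using q f_S by (auto intro: subring_of_diff[OF S])
    have "poly (f n) t \<in> I" using f(1) by (auto simp: P_def)
    moreover have "- 1 * poly q t \<in> I" using I_scale[OF m1] span_I[OF q(4)] by blast
    ultimately show "poly (f n - q) t \<in> I" using I_add by fastforce
    show "poly (f n - q) t \<notin> span_over ?T ?B"
    proof
      assume "poly (f n - q) t \<in> span_over ?T ?B"
      then have "poly (f n) t \<in> span_over ?T ?B" using span_over_add[OF _ q(4)] by fastforce
      then show False using f(1)[of n] by (simp add: P_def)
    qed
  qed
  \<comment> \<open>The zero polynomial is separated because its degree 0 is not below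
    \<open>?d\<close> when \<open>?d = 0\<close>; its value 0 lies in every span, which contradicts
    \<open>Pq\<close> as well.\<close>
  have "degree (f n - q) < ?d \<or> f n - q = 0"
  proof (rule disjCI)
    assume "f n - q \<noteq> 0"
    moreover have "degree (f n - q) \<le> ?d" using q(2) by (simp add: degree_diff_le)
    moreover have "coeff (f n - q) ?d = 0" using q(3) by simp
    ultimately show "degree (f n - q) < ?d" by (metis le_neq_implies_less leading_coeff_neq_0)
  qed
  then show False
  proof
    assume "f n - q = 0"
    then show False using Pq span_over.zero by (auto simp: P_def)
  qed (use f(2)[OF Pq] in simp)
qed

text \<open>Otherwise one could choose forever an element of \<open>I\<close> outside the span of
  those already chosen.\<close>

lemma noetherian_ring_on_ideal_fg:
  assumes S: "subring_of S" and noeth: "noetherian_ring_on S" and I: "I \<subseteq> S"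
  shows "\<exists>B. finite B \<and> B \<subseteq> I \<and> I \<subseteq> span_over S B"
proof (rule ccontr)
  assume contr: "\<not> ?thesis"
  define Q where "Q f n g \<longleftrightarrow> g \<in> I - span_over S (f ` {..<n})" for f :: "nat \<Rightarrow> 'a" and n :: nat and g
  have "\<exists>f. \<forall>n. Q f n (f n)"
  proof (rule dependent_wellorder_choice)
    fix f g :: "nat \<Rightarrow> 'a" and n :: nat and p
    assume "\<And>m. m < n \<Longrightarrow> f m = g m"
    then have "f ` {..<n} = g ` {..<n}" by (auto simp: image_iff)
    then show "Q f n p = Q g n p" by (simp add: Q_def)
  next
    fix n :: nat and f assume f: "\<And>m. m < n \<Longrightarrow> Q f m (f m)"
    then have "f ` {..<n} \<subseteq> I" by (auto simp: Q_def)
    then show "\<exists>p. Q f n p" using contr unfolding Q_def by blast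
  qed
  then obtain f where "\<And>n. Q f n (f n)" by auto
  then have "range f \<subseteq> S" "\<And>n. f n \<notin> span_over S (f ` {..<n})" using I by (auto simp: Q_def)
  then show False using noeth unfolding noetherian_ring_on_def by blast
qed

text \<open>Induction over the generators, starting from the field \<open>range \<kappa>\<close>.
  The resulting \<open>S\<close> contains the generated subalgebra, which in the application is the
  whole ring.\<close>

lemma noetherian_ring_on_finitely_generated:
  fixes \<kappa> :: "'k::field \<Rightarrow> 'r::comm_ring_1"
  assumes "\<kappa> 1 = 1" and "\<And>x y. \<kappa> (x + y) = \<kappa> x + \<kappa> y" and "\<And>x y. \<kappa> (x * y) = \<kappa> x * \<kappa> y"
    and "finite X"
  shows "\<exists>S. subring_of S \<and> noetherian_ring_on S \<and> range \<kappa> \<subseteq> S \<and> X \<subseteq> S"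
  using assms(4)
proof induction
  case empty
  have "\<kappa> 0 = 0" using assms(2)[of 0 0] by simp
  moreover have "\<kappa> (x - y) = \<kappa> x - \<kappa> y" for x y using assms(2)[of "x - y" y] by simp
  then have "\<kappa> x - \<kappa> y \<in> range \<kappa>" "\<kappa> x * \<kappa> y \<in> range \<kappa>" for x y
    by (metis rangeI, metis assms(3) rangeI)
  then have "subring_of (range \<kappa>)"
    unfolding subring_of_def using assms(1) by (metis (no_types, lifting) imageE rangeI)
  ultimately show ?case using noetherian_ring_on_range_field[of \<kappa>] assms by blast
next
  case (insert t X)
  then obtain S where "subring_of S" "noetherian_ring_on S" "range \<kappa> \<subseteq> S" "X \<subseteq> S" by blast
  then show ?case
    using adjoin_superset[of S t] subring_of_adjoin[of S t] noetherian_ring_on_adjoin[of S t]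
    by (intro exI[of _ "adjoin S t"]) auto
qed

section \<open>Graded free modules\<close>

text \<open>As rewrite rules these would replace sums of vectors by abstractions.\<close>

declare plus_fun_apply [simp del] and zero_fun_apply [simp del]

text \<open>The linear map with prescribed images of the basis elements. Differentials, the
  augmentation, chain maps and homotopies are all brought to this form, so that their compositions
  are instances of \<open>lincomb_lincomb\<close>.\<close>

definition lincomb :: "('a::comm_ring_1 \<Rightarrow> 'b::ab_group_add \<Rightarrow> 'b) \<Rightarrow> nat \<Rightarrow> (nat \<Rightarrow> 'b) \<Rightarrow> (nat \<Rightarrow> 'a) \<Rightarrow> 'b"
  where "lincomb scale r \<phi> v = (\<Sum>e<r. scale (v e) (\<phi> e))"

definition unit_vec :: "nat \<Rightarrow> nat \<Rightarrow> 'a::comm_ring_1" where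
  "unit_vec e = (\<lambda>i. if i = e then 1 else 0)"

lemma module_vscale: "module vscale"
  by unfold_locales (auto simp: vscale_def plus_fun_apply fun_eq_iff algebra_simps)

interpretation vec: module vscale
  by (rule module_vscale)

lemma vscale_apply: "vscale a v e = a * v e"
  by (simp add: vscale_def)

lemmas vec_apply = plus_fun_apply zero_fun_apply vscale_apply

lemma sum_fun_apply: "sum f I e = (\<Sum>i\<in>I. f i e)"
  by (induction I rule: infinite_finite_induct) (auto simp: vec_apply)

lemma minus_fun_apply: "(v - w) e = v e - (w e :: 'a::ab_group_add)"
  by (simp add: fun_diff_def)

context module
begin

lemma lincomb_add: "lincomb scale r \<phi> (v + w) = lincomb scale r \<phi> v + lincomb scale r \<phi> w"
  by (simp add: lincomb_def vec_apply scale_left_distrib sum.distrib)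

lemma lincomb_diff: "lincomb scale r \<phi> (v - w) = lincomb scale r \<phi> v - lincomb scale r \<phi> w"
  by (simp add: lincomb_def minus_fun_apply scale_left_diff_distrib sum_subtractf)

lemma lincomb_zero [simp]: "lincomb scale r \<phi> 0 = 0"
  by (simp add: lincomb_def vec_apply)

lemma lincomb_vscale: "lincomb scale r \<phi> (vscale a v) = scale a (lincomb scale r \<phi> v)"
  by (simp add: lincomb_def vec_apply scale_sum_right)

lemma lincomb_unit_vec: "e < r \<Longrightarrow> lincomb scale r \<phi> (unit_vec e) = \<phi> e"
  by (simp add: lincomb_def unit_vec_def if_distrib[of "\<lambda>a. scale a _"] cong: if_cong)

lemma lincomb_sum: "lincomb scale r \<phi> (sum f I) = (\<Sum>i\<in>I. lincomb scale r \<phi> (f i))"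
  by (induction I rule: infinite_finite_induct) (auto simp: lincomb_add)

lemma lincomb_lincomb:
  "lincomb scale r \<phi> (lincomb vscale q \<psi> w) = lincomb scale q (\<lambda>e. lincomb scale r \<phi> (\<psi> e)) w"
  unfolding lincomb_def[of vscale] lincomb_sum lincomb_vscale by (simp add: lincomb_def)

lemma lincomb_mem:
  "subspace K \<Longrightarrow> (\<And>e. e < r \<Longrightarrow> \<phi> e \<in> K) \<Longrightarrow> lincomb scale r \<phi> v \<in> K"
  unfolding lincomb_def by (intro subspace_sum subspace_scale) auto

lemma lincomb_cong:
  "(\<And>e. e < r \<Longrightarrow> \<phi> e = \<psi> e) \<Longrightarrow> lincomb scale r \<phi> v = lincomb scale r \<psi> v"
  by (simp add: lincomb_def)

end

lemma subspace_free_module: "vec.subspace (free_module r)"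
  by (auto simp: vec.subspace_def free_module_def vec_apply)

lemma unit_vec_mem: "e < r \<Longrightarrow> unit_vec e \<in> free_module r"
  by (simp add: free_module_def unit_vec_def)

lemma lincomb_unit_vecs: "v \<in> free_module r \<Longrightarrow> lincomb vscale r unit_vec v = v"
  by (auto simp: lincomb_def fun_eq_iff sum_fun_apply vscale_apply free_module_def unit_vec_def
      if_distrib[of "\<lambda>a. _ * a"] cong: if_cong)

context module
begin

lemma span_eq_lincomb_image: "lincomb scale r \<phi> ` free_module r = span (\<phi> ` {..<r})"
proof
  show "lincomb scale r \<phi> ` free_module r \<subseteq> span (\<phi> ` {..<r})"
    by (auto intro: lincomb_mem span_base)
  have "subspace (lincomb scale r \<phi> ` free_module r)"
    unfolding subspace_def
  proof (intro conjI ballI allI)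
    show "0 \<in> lincomb scale r \<phi> ` free_module r"
      using vec.subspace_0[OF subspace_free_module] by (metis imageI lincomb_zero)
  qed (auto simp flip: lincomb_add lincomb_vscale
      intro!: imageI vec.subspace_add vec.subspace_scale subspace_free_module)
  moreover have "\<phi> ` {..<r} \<subseteq> lincomb scale r \<phi> ` free_module r"
  proof
    fix x assume "x \<in> \<phi> ` {..<r}"
    then obtain e where "e < r" "x = lincomb scale r \<phi> (unit_vec e)"
      using lincomb_unit_vec by (metis imageE lessThan_iff)
    then show "x \<in> lincomb scale r \<phi> ` free_module r" using unit_vec_mem by blast
  qed
  ultimately show "span (\<phi> ` {..<r}) \<subseteq> lincomb scale r \<phi> ` free_module r"
    by (intro span_minimal)
qed

end

context standard_graded_algebra
begin

text \<open>Expanding a vector in unit vectors makes minimality and the standard filtration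
  conditions on single entries.\<close>

lemma ideal_times_free_module:
  assumes J: "ring_ideal J"
  shows "ideal_times J (free_module r) = {v \<in> free_module r. \<forall>e. v e \<in> J}" (is "_ = ?V")
proof
  have "vec.subspace ?V"
    using J by (auto simp: vec.subspace_def ring_ideal_iff vec_apply free_module_def)
  moreover have "{vscale a v | a v. a \<in> J \<and> v \<in> free_module r} \<subseteq> ?V"
    using J by (auto simp: ring_ideal_iff vec_apply free_module_def) (metis mult.commute)
  ultimately show "ideal_times J (free_module r) \<subseteq> ?V"
    unfolding ideal_times_def by (intro vec.span_minimal)
  show "?V \<subseteq> ideal_times J (free_module r)"
  proof
    fix v assume v: "v \<in> ?V"
    then have "v = (\<Sum>e<r. vscale (v e) (unit_vec e))"
      using lincomb_unit_vecs[of v r] by (simp add: lincomb_def)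
    also have "\<dots> \<in> ideal_times J (free_module r)"
      unfolding ideal_times_def
      by (intro vec.span_sum vec.span_base) (use v unit_vec_mem in blast)
    finally show "v \<in> ideal_times J (free_module r)" .
  qed
qed

section \<open>Finite generation of submodules of free modules\<close>

lemma ideal_fg:
  assumes "ring_ideal J"
  shows "\<exists>B. finite B \<and> B \<subseteq> J \<and> J \<subseteq> module.span (*) B"
proof -
  interpret R: module "(*) :: 'r \<Rightarrow> 'r \<Rightarrow> 'r" by (rule module_self)
  obtain X where X: "finite X" "generated_subalgebra \<kappa> X = UNIV" using generated by auto
  obtain S where S: "subring_of S" "noetherian_ring_on S" "range \<kappa> \<subseteq> S" "X \<subseteq> S"
    using noetherian_ring_on_finitely_generated[of \<kappa> X] kappa_one kappa_add kappa_mult X(1) by metis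
  have "a \<in> S" if "a \<in> generated_subalgebra \<kappa> X" for a
    using that by induction (use S in \<open>auto intro: subring_of_add subring_of_mult\<close>)
  then have "J \<subseteq> S" using X by auto
  from noetherian_ring_on_ideal_fg[OF S(1,2) this]
  obtain B where B: "finite B" "B \<subseteq> J" "J \<subseteq> span_over S B" by (elim exE conjE)
  have "x \<in> R.span B" if "x \<in> span_over S B" for x
    using that by induction (auto intro: R.span_zero R.span_add R.span_scale R.span_base)
  then show ?thesis using B by blast
qed

text \<open>Induction on the rank: the last coordinates of \<open>K\<close> form an ideal, whose
  generators lift to \<open>C\<close>; what remains after subtracting a combination of
  \<open>C\<close> has last coordinate zero and lies in rank \<open>r\<close>.\<close>

lemma submodule_fg:
  "vec.subspace K \<Longrightarrow> K \<subseteq> free_module r \<Longrightarrow> \<exists>B. finite B \<and> B \<subseteq> (K :: (nat \<Rightarrow> 'r) set) \<and> K \<subseteq> vec.span B"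
proof (induction r arbitrary: K)
  case 0
  then have "K \<subseteq> {0}" by (auto simp: free_module_def fun_eq_iff zero_fun_apply)
  then show ?case by (intro exI[of _ "{}"]) auto
next
  case (Suc r)
  interpret R: module "(*) :: 'r \<Rightarrow> 'r \<Rightarrow> 'r" by (rule module_self)
  let ?\<pi> = "\<lambda>v :: nat \<Rightarrow> 'r. v r"
  have "ring_ideal (?\<pi> ` K)"
    unfolding ring_ideal_iff
  proof (intro conjI ballI allI)
    show "0 \<in> ?\<pi> ` K"
      by (rule image_eqI[where f = ?\<pi>, OF zero_fun_apply[symmetric] vec.subspace_0[OF Suc.prems(1)]])
  next
    fix x y assume "x \<in> ?\<pi> ` K" "y \<in> ?\<pi> ` K"
    then obtain v w where vw: "v \<in> K" "w \<in> K" "x = v r" "y = w r" by blast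
    show "x + y \<in> ?\<pi> ` K"
      unfolding vw
      by (rule image_eqI[where f = ?\<pi>, OF plus_fun_apply[symmetric] vec.subspace_add[OF Suc.prems(1) vw(1,2)]])
  next
    fix a x assume "x \<in> ?\<pi> ` K"
    then obtain v where v: "v \<in> K" "x = v r" by blast
    show "a * x \<in> ?\<pi> ` K"
      unfolding v
      by (rule image_eqI[where f = ?\<pi>, OF vscale_apply[symmetric] vec.subspace_scale[OF Suc.prems(1) v(1)]])
  qed
  then obtain B where B: "finite B" "B \<subseteq> ?\<pi> ` K" "?\<pi> ` K \<subseteq> R.span B" using ideal_fg by blast
  obtain C where C: "finite C" "C \<subseteq> K" "B = ?\<pi> ` C" using finite_subset_image[OF B(1,2)] by blast
  have lift: "\<exists>w\<in>vec.span C. w r = x" if "x \<in> R.span B" for x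
    using that unfolding C(3)
  proof (induction rule: R.span_induct_alt)
    case base
    show ?case by (rule bexI[of "\<lambda>w. w r = 0", OF zero_fun_apply vec.span_zero])
  next
    case (step a b x)
    then obtain v w where "v \<in> C" "b = v r" "w \<in> vec.span C" "w r = x" by auto
    then show ?case
      by (intro bexI[of _ "vscale a v + w"] vec.span_add vec.span_scale)
        (auto simp: vec_apply intro: vec.span_base)
  qed
  have "vec.subspace (K \<inter> free_module r)" by (intro vec.subspace_inter Suc.prems subspace_free_module)
  then obtain E where E: "finite E" "E \<subseteq> K \<inter> free_module r" "K \<inter> free_module r \<subseteq> vec.span E"
    using Suc.IH[of "K \<inter> free_module r"] by auto
  have "K \<subseteq> vec.span (C \<union> E)"
  proof
    fix v assume v: "v \<in> K"
    then obtain w where w: "w \<in> vec.span C" "w r = v r" using lift B(3) by blast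
    have "w \<in> K" using w(1) vec.span_minimal[OF C(2) Suc.prems(1)] by blast
    then have "v - w \<in> K" using v vec.subspace_diff[OF Suc.prems(1)] by blast
    moreover have "v - w \<in> free_module r"
      unfolding free_module_def
    proof (intro CollectI allI impI)
      fix e assume e: "r \<le> e"
      have vw: "v \<in> free_module (Suc r)" "w \<in> free_module (Suc r)"
        using v \<open>w \<in> K\<close> Suc.prems(2) by auto
      from e consider "e = r" | "Suc r \<le> e" by linarith
      then show "(v - w) e = 0"
        using vw w(2) by cases (auto simp: minus_fun_apply free_module_def)
    qed
    ultimately have "v - w \<in> vec.span (C \<union> E)" using E(3) vec.span_mono[of E "C \<union> E"] by blast
    moreover have "w \<in> vec.span (C \<union> E)" using w(1) vec.span_mono[of C "C \<union> E"] by blast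
    ultimately show "v \<in> vec.span (C \<union> E)" using vec.span_add[of "v - w" _ w] by simp
  qed
  moreover have "finite (C \<union> E)" "C \<union> E \<subseteq> K" using C(1,2) E(1,2) by auto
  ultimately show ?case by (intro exI[of _ "C \<union> E"] conjI)
qed

text \<open>Here \<open>s e\<close> is the degree of the basis element \<open>e\<close>.\<close>

definition vcomp :: "(nat \<Rightarrow> int) \<Rightarrow> int \<Rightarrow> (nat \<Rightarrow> 'r) \<Rightarrow> nat \<Rightarrow> 'r" where
  "vcomp s j v = (\<lambda>e. hcomp D (v e) (j - s e))"

definition vhom :: "(nat \<Rightarrow> int) \<Rightarrow> int \<Rightarrow> (nat \<Rightarrow> 'r) set" where
  "vhom s j = {v. \<forall>e. v e \<in> D (j - s e)}"

lemma vcomp_mem_vhom: "vcomp s j v \<in> vhom s j"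
  by (simp add: vcomp_def vhom_def hc_mem)

lemma vcomp_of_vhom: "v \<in> vhom s i \<Longrightarrow> vcomp s j v = (if j = i then v else 0)"
proof -
  assume "v \<in> vhom s i"
  then have "v e \<in> D (i - s e)" for e by (simp add: vhom_def)
  from hc_of_mem[OF this] show ?thesis by (auto simp: vcomp_def fun_eq_iff zero_fun_apply)
qed

lemma vcomp_free_module: "v \<in> free_module r \<Longrightarrow> vcomp s j v \<in> free_module r"
  by (simp add: vcomp_def free_module_def)

lemma sum_vcomp:
  assumes "v \<in> free_module r"
  shows "\<exists>J. finite J \<and> v = (\<Sum>j\<in>J. vcomp s j v)"
proof -
  \<comment> \<open>All degrees in which some entry contributes; entry \<open>e\<close> of degree
    \<open>i\<close> sits in total degree \<open>i + s e\<close>.\<close>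
  let ?J = "\<Union>e<r. (\<lambda>i. i + s e) ` {i. hcomp D (v e) i \<noteq> 0}"
  have "(\<Sum>j\<in>?J. vcomp s j v) e = v e" for e
  proof (cases "e < r")
    case True
    have "(\<Sum>j\<in>?J. hcomp D (v e) (j - s e)) = (\<Sum>i\<in>(\<lambda>j. j - s e) ` ?J. hcomp D (v e) i)"
      by (simp add: sum.reindex inj_on_def)
    also have "\<dots> = v e"
    proof (rule hcomp_sum_superset[OF int_grading])
      show "{i. hcomp D (v e) i \<noteq> 0} \<subseteq> (\<lambda>j. j - s e) ` ?J"
      proof
        fix i assume "i \<in> {i. hcomp D (v e) i \<noteq> 0}"
        then have "i + s e \<in> ?J" using True by blast
        then show "i \<in> (\<lambda>j. j - s e) ` ?J" by (intro image_eqI[of _ _ "i + s e"]) auto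
      qed
    qed (auto simp: hc_finite)
    finally show ?thesis by (simp add: sum_fun_apply vcomp_def)
  next
    case False
    then show ?thesis using assms by (simp add: sum_fun_apply vcomp_def free_module_def)
  qed
  then show ?thesis by (intro exI[of _ ?J]) (auto simp: hc_finite)
qed

end

text \<open>\<open>c j\<close> is the projection to degree \<open>j\<close>. Both \<open>N\<close>
  and the shifted free modules are instances, so the first step of a resolution and all later ones
  share the same lemmas on generators and kernels.\<close>

locale homogeneous_components =
  standard_graded_algebra \<kappa> A + module scale
  for \<kappa> :: "'k::field \<Rightarrow> 'r::comm_ring_1" and A :: "nat \<Rightarrow> 'r set"
    and scale :: "'r \<Rightarrow> 'b::ab_group_add \<Rightarrow> 'b" +
  fixes H :: "int \<Rightarrow> 'b set" and c :: "int \<Rightarrow> 'b \<Rightarrow> 'b"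
  assumes comp_add: "c j (x + y) = c j x + c j y"
    and comp_scale: "x \<in> H i \<Longrightarrow> c j (scale a x) = scale (hcomp (degree_part A) a (j - i)) x"
begin

lemma comp_zero [simp]: "c j 0 = 0"
  using comp_add[of j 0 0] by simp

lemma comp_sum: "c j (sum f I) = (\<Sum>i\<in>I. c j (f i))"
  by (induction I rule: infinite_finite_induct) (auto simp: comp_add)

text \<open>A linear map that sends basis elements to homogeneous elements of their own degree
  commutes with the projections.\<close>

lemma comp_lincomb:
  "(\<And>e. e < r \<Longrightarrow> \<phi> e \<in> H (s e)) \<Longrightarrow>
    c j (lincomb scale r \<phi> v) = lincomb scale r \<phi> (vcomp s j v)"
  unfolding lincomb_def comp_sum vcomp_def by (intro sum.cong refl comp_scale) simp

text \<open>Among the finite sets of homogeneous generators, one of least cardinality is taken. A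
  relation with a coefficient outside \<open>\<mm>\<close> would make one generator
  redundant.\<close>

lemma minimal_generators:
  assumes K: "subspace K" and fg: "finite B" "B \<subseteq> K" "K \<subseteq> span B"
    and comp: "\<And>x j. x \<in> K \<Longrightarrow> c j x \<in> K \<inter> H j"
    and sum: "\<And>x. x \<in> K \<Longrightarrow> \<exists>J. finite J \<and> x = (\<Sum>j\<in>J. c j x)"
  shows "\<exists>r s \<phi>. (\<forall>e<r. \<phi> e \<in> K \<inter> H (s e)) \<and> lincomb scale r \<phi> ` free_module r = K \<and>
    (\<forall>v\<in>free_module r. lincomb scale r \<phi> v = 0 \<longrightarrow> (\<forall>e. v e \<in> \<mm>))"
proof -
  define P where "P S \<longleftrightarrow> finite S \<and> S \<subseteq> (\<Union>j. K \<inter> H j) \<and> span S = K" for S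
  obtain J where J: "\<And>b. b \<in> B \<Longrightarrow> finite (J b) \<and> b = (\<Sum>j\<in>J b. c j b)"
    using sum fg(2) by (metis subset_iff)
  let ?S = "\<Union>b\<in>B. (\<lambda>j. c j b) ` J b"
  have "P ?S"
    unfolding P_def
  proof (intro conjI)
    show "finite ?S" using fg J by auto
    show sub: "?S \<subseteq> (\<Union>j. K \<inter> H j)" using comp fg(2) by blast
    have "b \<in> span ?S" if "b \<in> B" for b
    proof -
      have "(\<Sum>j\<in>J b. c j b) \<in> span ?S" using that by (intro span_sum span_base) blast
      then show ?thesis using J[OF that] by simp
    qed
    then have "K \<subseteq> span ?S" using fg(3) span_minimal[OF _ subspace_span, of B ?S] by blast
    moreover have "span ?S \<subseteq> K" using sub by (intro span_minimal K) blast
    ultimately show "span ?S = K" by blast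
  qed
  then obtain S where S: "P S" "\<And>T. P T \<Longrightarrow> card S \<le> card T"
    using ex_has_least_nat[of P _ card] by blast
  define r where "r = card S"
  obtain \<phi> where \<phi>: "bij_betw \<phi> {..<r} S"
    using ex_bij_betw_nat_finite[of S] S(1) unfolding P_def r_def by (auto simp: atLeast0LessThan)
  have \<phi>_mem: "\<phi> e \<in> S" if "e < r" for e using \<phi> that by (auto simp: bij_betw_def)
  then have "\<exists>j. \<phi> e \<in> K \<inter> H j" if "e < r" for e using S(1) that unfolding P_def by blast
  then obtain s where s: "\<And>e. e < r \<Longrightarrow> \<phi> e \<in> K \<inter> H (s e)" by metis
  have "lincomb scale r \<phi> ` free_module r = K"
    using S(1) \<phi> by (simp add: span_eq_lincomb_image bij_betw_def P_def)
  moreover have "v e \<in> \<mm>" if v: "v \<in> free_module r" "lincomb scale r \<phi> v = 0" for v e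
  proof (rule ccontr)
    assume notin: "v e \<notin> \<mm>"
    then have e: "e < r" using v(1) irrelevant_0 by (auto simp: free_module_def not_less[symmetric])
    define w where "w = vcomp s (s e) v"
    \<comment> \<open>The relation is restricted to the degree of the generator
      \<open>\<phi> e\<close>; its coefficient there becomes the degree 0 part of
      \<open>v e\<close>, a nonzero scalar that can be inverted.\<close>
    have "lincomb scale r \<phi> w = 0"
      using comp_lincomb[of r \<phi> s "s e" v] s v(2) unfolding w_def by simp
    then have "scale (w e) (\<phi> e) = - (\<Sum>i\<in>{..<r} - {e}. scale (w i) (\<phi> i))"
      using e by (simp add: lincomb_def sum.remove add_eq_0_iff)
    moreover have "(\<Sum>i\<in>{..<r} - {e}. scale (w i) (\<phi> i)) \<in> span (S - {\<phi> e})"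
      using \<phi> e by (intro span_sum span_scale span_base) (auto simp: bij_betw_def inj_on_def)
    ultimately have in_span: "scale (w e) (\<phi> e) \<in> span (S - {\<phi> e})" by (simp add: span_neg)
    obtain b where b: "w e = \<kappa> b" "b \<noteq> 0"
      using notin kappa_residue[of "v e"] residue_eq_0_iff[of "v e"]
      by (metis diff_self vcomp_def w_def)
    have "\<kappa> (inverse b) * \<kappa> b = 1" using b(2) by (simp flip: kappa_mult add: kappa_one)
    then have "\<phi> e \<in> span (S - {\<phi> e})"
      using span_scale[OF in_span, of "\<kappa> (inverse b)"] by (simp add: b(1))
    then have "insert (\<phi> e) (S - {\<phi> e}) \<subseteq> span (S - {\<phi> e})"
      by (intro insert_subsetI span_superset)
    then have "span S \<subseteq> span (S - {\<phi> e})"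
      by (intro span_minimal subspace_span) auto
    then have "span (S - {\<phi> e}) = span S" using span_mono[of "S - {\<phi> e}" S] by auto
    then have "P (S - {\<phi> e})" using S(1) by (auto simp: P_def)
    then have "card S \<le> card (S - {\<phi> e})" by (rule S(2))
    moreover have "card (S - {\<phi> e}) < card S"
      using S(1) \<phi>_mem[OF e] by (intro psubset_card_mono) (auto simp: P_def)
    ultimately show False by simp
  qed
  ultimately show ?thesis using s by blast
qed

end

context standard_graded_algebra
begin

lemma homogeneous_components_vec: "homogeneous_components \<kappa> A vscale (vhom s) (vcomp s)"
proof (intro homogeneous_components.intro homogeneous_components_axioms.intro
    standard_graded_algebra_axioms module_vscale)
  show "vcomp s j (x + y) = vcomp s j x + vcomp s j y" for j x y
    by (simp add: vcomp_def fun_eq_iff plus_fun_apply hc_add)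
  fix x i j a assume "x \<in> vhom s i"
  then have "x e \<in> D (i - s e)" for e by (simp add: vhom_def)
  from hc_mult_homogeneous[OF this] show "vcomp s j (vscale a x) = vscale (hcomp D a (j - i)) x"
    by (simp add: vcomp_def vscale_apply fun_eq_iff)
qed

definition graded_submodule :: "nat \<Rightarrow> (nat \<Rightarrow> int) \<Rightarrow> (nat \<Rightarrow> 'r) set \<Rightarrow> bool" where
  "graded_submodule r s K \<longleftrightarrow> vec.subspace K \<and> K \<subseteq> free_module r \<and>
    (\<forall>x\<in>K. \<forall>j. vcomp s j x \<in> K)"

lemma graded_submodule_minimal_generators:
  assumes "graded_submodule r s K"
  shows "\<exists>q s' \<phi>. (\<forall>e<q. \<phi> e \<in> K \<inter> vhom s (s' e)) \<and> lincomb vscale q \<phi> ` free_module q = K \<and>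
    (\<forall>v\<in>free_module q. lincomb vscale q \<phi> v = 0 \<longrightarrow> (\<forall>e. v e \<in> \<mm>))"
proof -
  interpret hom: homogeneous_components \<kappa> A vscale "vhom s" "vcomp s"
    by (rule homogeneous_components_vec)
  have K: "vec.subspace K" "K \<subseteq> free_module r" "\<And>x j. x \<in> K \<Longrightarrow> vcomp s j x \<in> K"
    using assms by (auto simp: graded_submodule_def)
  obtain B where B: "finite B" "B \<subseteq> K" "K \<subseteq> vec.span B"
    using submodule_fg[OF K(1,2)] by (elim exE conjE)
  show ?thesis
  proof (rule hom.minimal_generators[OF K(1) B])
    show "vcomp s j x \<in> K \<inter> vhom s j" if "x \<in> K" for x j
      using K(3)[OF that] vcomp_mem_vhom by (rule IntI)
    show "\<exists>J. finite J \<and> x = (\<Sum>j\<in>J. vcomp s j x)" if "x \<in> K" for x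
      by (rule sum_vcomp) (use K(2) that in blast)
  qed
qed

end

context homogeneous_components
begin

lemma graded_submodule_kernel:
  assumes "\<And>e. e < r \<Longrightarrow> \<phi> e \<in> H (s e)"
  shows "graded_submodule r s {v \<in> free_module r. lincomb scale r \<phi> v = 0}"
proof -
  have "lincomb scale r \<phi> (vcomp s j v) = 0" if "lincomb scale r \<phi> v = 0" for j v
    using comp_lincomb[of r \<phi> s j v] assms that by simp
  moreover have "vec.subspace {v \<in> free_module r. lincomb scale r \<phi> v = 0}"
    using subspace_free_module[of r]
    unfolding vec.subspace_def by (auto simp: lincomb_add lincomb_vscale)
  ultimately show ?thesis by (auto simp: graded_submodule_def vcomp_free_module)
qed

end

section \<open>Existence of minimal resolutions\<close>

text \<open>The entries of \<open>mat\<close> beyond the rank are arbitrary, so the columns are cut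
  off to become elements of the free module.\<close>

definition bd_cols :: "('r::comm_ring_1, 'm) free_cpx \<Rightarrow> nat \<Rightarrow> nat \<Rightarrow> nat \<Rightarrow> 'r" where
  "bd_cols F n e = (\<lambda>i. if i < rank F n then mat F n i e else 0)"

lemma bd_Suc_lincomb: "bd F (Suc n) v = lincomb vscale (rank F (Suc n)) (bd_cols F n) v"
  by (auto simp: lincomb_def bd_cols_def fun_eq_iff sum_fun_apply vscale_apply mult.commute)

lemma bd_0: "bd F 0 v = 0"
  by (simp add: fun_eq_iff zero_fun_apply)

lemma bd_add: "bd F n (v + w) = bd F n v + bd F n w"
  by (cases n) (simp_all only: bd_0 bd_Suc_lincomb vec.lincomb_add add_0)

lemma bd_diff: "bd F n (v - w) = bd F n v - bd F n w"
  by (cases n) (simp_all only: bd_0 bd_Suc_lincomb vec.lincomb_diff diff_0_right)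

lemma bd_zero: "bd F n 0 = 0"
  using bd_add[of F n 0 0] by simp

lemma bd_lincomb: "bd F n (lincomb vscale r \<phi> v) = lincomb vscale r (\<lambda>e. bd F n (\<phi> e)) v"
proof (cases n)
  case 0
  show ?thesis unfolding 0 bd_0 lincomb_def by (simp only: vec.scale_zero_right sum.neutral_const)
qed (simp only: bd_Suc_lincomb vec.lincomb_lincomb)

lemma bd_mem_chain: "bd F n v \<in> chain F (n - 1)"
  by (cases n) (auto simp: chain_def free_module_def)

text \<open>As \<open>bd F 0\<close> is zero, its kernel would be all of \<open>F_0\<close>; using
  the augmentation instead at \<open>n = 0\<close> gives exactness the same form in every
  degree.\<close>

definition syzygies ::
  "('r::comm_ring_1 \<Rightarrow> 'm::ab_group_add \<Rightarrow> 'm) \<Rightarrow> ('r, 'm) free_cpx \<Rightarrow> nat \<Rightarrow> (nat \<Rightarrow> 'r) set" where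
  "syzygies smul F n =
     {v \<in> chain F n. if n = 0 then aug_map smul F v = 0 else bd F n v = 0}"

lemma aug_map_lincomb: "aug_map smul F v = lincomb smul (rank F 0) (aug F) v"
  by (simp add: aug_map_def lincomb_def)

context fg_graded_module
begin

lemma homogeneous_components_module: "homogeneous_components \<kappa> A smul N (\<lambda>j x. hcomp N x j)"
proof (intro homogeneous_components.intro homogeneous_components_axioms.intro
    standard_graded_algebra_axioms module_axioms)
  fix a x i j
  have "smul a x \<in> N (i + j)" if "a \<in> D i" "x \<in> N j" for a i x j
    using graded_smul[of a "nat i" x j] that grading_zero[OF module_grading, of "i + j"]
    by (cases "i < 0") (auto simp: degree_part_nonneg)
  then show "x \<in> N i \<Longrightarrow> hcomp N (smul a x) j = smul (hcomp D a (j - i)) x"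
    by (intro hcomp_scale_homogeneous module_axioms module_grading)
qed (rule hcomp_add[OF module_grading])

lemma sum_hcomp: "\<exists>J. finite J \<and> x = (\<Sum>j\<in>J. hcomp N x j)"
  using hcomp_sum[OF module_grading] hcomp_finite[OF module_grading] by metis

text \<open>Minimal homogeneous generators of each kernel are the next basis. Minimality of the
  generators says that their relations have entries in \<open>\<mm>\<close>, which is the minimality
  of the resolution one step later.\<close>

lemma minimal_graded_free_resolution_exists:
  "\<exists>F :: ('r, 'm) free_cpx. minimal_graded_free_resolution A smul N F"
proof -
  interpret M: homogeneous_components \<kappa> A smul N "\<lambda>j x. hcomp N x j"
    by (rule homogeneous_components_module)
  obtain X where X: "finite X" "span X = UNIV" using finitely_generated by blast
  have "\<exists>r s \<phi>. (\<forall>e<r. \<phi> e \<in> UNIV \<inter> N (s e)) \<and> lincomb smul r \<phi> ` free_module r = UNIV \<and>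
    (\<forall>v\<in>free_module r. lincomb smul r \<phi> v = 0 \<longrightarrow> (\<forall>e. v e \<in> \<mm>))"
    by (rule M.minimal_generators[OF subspace_UNIV X(1)])
      (auto simp: X(2) hcomp_mem[OF module_grading] sum_hcomp)
  then obtain r s \<phi> where *: "\<forall>e<r. \<phi> e \<in> UNIV \<inter> N (s e)"
    "lincomb smul r \<phi> ` free_module r = UNIV"
    "\<forall>v\<in>free_module r. lincomb smul r \<phi> v = 0 \<longrightarrow> (\<forall>e. v e \<in> \<mm>)" by (elim exE conjE)
  then have \<phi>: "\<And>e. e < r \<Longrightarrow> \<phi> e \<in> N (s e)"
    "lincomb smul r \<phi> ` free_module r = UNIV"
    "\<And>v e. v \<in> free_module r \<Longrightarrow> lincomb smul r \<phi> v = 0 \<Longrightarrow> v e \<in> \<mm>" by simp_all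
  define K0 where "K0 = {v \<in> free_module r. lincomb smul r \<phi> v = 0}"
  \<comment> \<open>A state consists of the rank and shifts of \<open>F_n\<close>, the images of its
    basis elements, and the kernel \<open>K\<close> still to be covered.\<close>
  define P where "P n t \<longleftrightarrow> (case t of (q :: nat, s', \<psi> :: nat \<Rightarrow> nat \<Rightarrow> 'r, K) \<Rightarrow>
      graded_submodule q s' K \<and> (\<forall>v\<in>K. \<forall>e. v e \<in> \<mm>) \<and> (n = (0::nat) \<longrightarrow> q = r \<and> s' = s \<and> K = K0))" for n t
  define Q where "Q n t t' \<longleftrightarrow> (case t of (q :: nat, s', \<psi> :: nat \<Rightarrow> nat \<Rightarrow> 'r, K) \<Rightarrow>
      case t' of (q', s'', \<psi>', K') \<Rightarrow>
        (\<forall>e<q'. \<psi>' e \<in> K \<inter> vhom s' (s'' e)) \<and> lincomb vscale q' \<psi>' ` free_module q' = K \<and>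
        K' = {v \<in> free_module q'. lincomb vscale q' \<psi>' v = 0})"
    for n :: nat and t t'
  have "\<exists>f. \<forall>n. P n (f n) \<and> Q n (f n) (f (Suc n))"
  proof (rule dependent_nat_choice)
    have "graded_submodule r s K0" unfolding K0_def by (rule M.graded_submodule_kernel[OF \<phi>(1)])
    \<comment> \<open>The zero columns are a placeholder: nothing is mapped from \<open>F_0\<close>
      except by the augmentation \<phi>.\<close>
    then have "P 0 (r, s, \<lambda>_ _. 0, K0)" using \<phi>(3) by (auto simp: P_def K0_def)
    then show "\<exists>t. P 0 t" by blast
  next
    fix t n assume "P n t"
    moreover obtain q s' \<psi> K where t: "t = (q, s', \<psi>, K)" by (cases t) auto
    ultimately have K: "graded_submodule q s' K" by (simp add: P_def)
    interpret V: homogeneous_components \<kappa> A vscale "vhom s'" "vcomp s'"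
      by (rule homogeneous_components_vec)
    from graded_submodule_minimal_generators[OF K] obtain q' s'' \<psi>' where
      \<psi>': "\<forall>e<q'. \<psi>' e \<in> K \<inter> vhom s' (s'' e)" "lincomb vscale q' \<psi>' ` free_module q' = K"
      "\<forall>v\<in>free_module q'. lincomb vscale q' \<psi>' v = 0 \<longrightarrow> (\<forall>e. v e \<in> \<mm>)" by (elim exE conjE)
    let ?K' = "{v \<in> free_module q'. lincomb vscale q' \<psi>' v = 0}"
    have "graded_submodule q' s'' ?K'" by (rule V.graded_submodule_kernel) (use \<psi>'(1) in blast)
    then have "P (Suc n) (q', s'', \<psi>', ?K')" using \<psi>'(3) by (simp add: P_def)
    moreover have "Q n t (q', s'', \<psi>', ?K')" using \<psi>'(1,2) by (simp add: Q_def t)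
    ultimately show "\<exists>t'. P (Suc n) t' \<and> Q n t t'" by blast
  qed
  then obtain f where f: "\<And>n. P n (f n)" "\<And>n. Q n (f n) (f (Suc n))" by blast
  define q s' \<psi> K where "q n = fst (f n)" and "s' n = fst (snd (f n))"
    and "\<psi> n = fst (snd (snd (f n)))" and "K n = snd (snd (snd (f n)))" for n
  have "f n = (q n, s' n, \<psi> n, K n)" for n by (simp add: q_def s'_def \<psi>_def K_def)
  note f = f[unfolded P_def Q_def this prod.case]
  have K_sub: "K n \<subseteq> free_module (q n)" and K_m: "\<forall>v\<in>K n. \<forall>e. v e \<in> \<mm>" for n
    using f(1)[of n] by (auto simp: graded_submodule_def)
  \<comment> \<open>State \<open>n + 1\<close> stores the columns of the map into
    \<open>F_n\<close>, whence \<open>Suc n\<close>; the arguments are swapped because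
    \<open>mat\<close> takes the row first.\<close>
  define F where "F = \<lparr>rank = q, shift = s', mat = \<lambda>n i e. \<psi> (Suc n) e i, aug = \<phi>\<rparr>"
  have [simp]: "rank F = q" "shift F = s'" "aug F = \<phi>" "mat F n i e = \<psi> (Suc n) e i" for n i e
    by (simp_all add: F_def)
  have cols: "bd_cols F n e = \<psi> (Suc n) e" if "e < q (Suc n)" for n e
  proof -
    have "\<psi> (Suc n) e \<in> free_module (q n)" using f(2)[of n] that K_sub[of n] by blast
    then show ?thesis by (auto simp: bd_cols_def fun_eq_iff free_module_def)
  qed
  have bd: "bd F (Suc n) = lincomb vscale (q (Suc n)) (\<psi> (Suc n))" for n
  proof
    fix v show "bd F (Suc n) v = lincomb vscale (q (Suc n)) (\<psi> (Suc n)) v"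
      unfolding bd_Suc_lincomb by (simp add: cols vec.lincomb_cong[OF cols])
  qed
  have image: "bd F (Suc n) ` chain F (Suc n) = K n" for n
    using f(2)[of n] by (simp add: bd chain_def)
  have kernel: "K n = {v \<in> chain F n. bd F n v = 0}" if "n \<ge> 1" for n
  proof -
    obtain m where "n = Suc m" using \<open>n \<ge> 1\<close> by (cases n) auto
    then show ?thesis using f(2)[of m] by (simp only: bd chain_def \<open>rank F = q\<close>)
  qed
  have 0: "q 0 = r" "s' 0 = s" "K 0 = K0" using f(1)[of 0] by simp_all
  have "graded_free_resolution A smul N F"
    unfolding graded_free_resolution_def
  proof (intro conjI allI impI)
    fix n i e assume "e < rank F (Suc n)"
    then have "\<psi> (Suc n) e \<in> vhom (s' n) (s' (Suc n) e)" using f(2)[of n] by simp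
    then show "mat F n i e \<in> degree_part A (shift F (Suc n) e - shift F n i)"
      by (simp add: vhom_def)
  next
    show "aug_map smul F ` chain F 0 = UNIV"
      using \<phi>(2) by (simp add: aug_map_lincomb[abs_def] chain_def 0)
    show "{v \<in> chain F 0. aug_map smul F v = 0} = bd F 1 ` chain F 1"
      using image[of 0] by (simp add: aug_map_lincomb chain_def 0 K0_def)
    show "{v \<in> chain F n. bd F n v = 0} = bd F (Suc n) ` chain F (Suc n)" if "n \<ge> 1" for n
      unfolding image kernel[OF that] ..
  qed (use \<phi>(1) 0 in simp)
  moreover have "bd F (Suc n) ` chain F (Suc n) \<subseteq> ideal_times \<mm> (chain F n)" for n
    unfolding image unfolding chain_def ideal_times_free_module[OF ring_ideal_irrelevant]
    using K_sub[of n] K_m[of n] by auto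
  ultimately have "minimal_graded_free_resolution A smul N F"
    by (simp add: minimal_graded_free_resolution_def)
  then show ?thesis ..
qed

end

section \<open>Comparison of resolutions\<close>

declare bd.simps [simp del]

lemma (in module) lincomb_cols_diff:
  "lincomb scale r (\<lambda>e. \<phi> e - \<psi> e) v = lincomb scale r \<phi> v - lincomb scale r \<psi> v"
  by (simp add: lincomb_def scale_right_diff_distrib sum_subtractf)

context standard_graded_algebra
begin

lemma lincomb_vhom:
  assumes \<phi>: "\<And>e. e < r \<Longrightarrow> \<phi> e \<in> vhom s' (s e)" and v: "v \<in> vhom s j"
  shows "lincomb vscale r \<phi> v \<in> vhom s' j"
proof -
  have "v e * \<phi> e i \<in> D (j - s' i)" if "e < r" for e i
    using deg_mult[of "v e" "j - s e" "\<phi> e i" "s e - s' i"] \<phi>[OF that] v by (simp add: vhom_def)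
  then show ?thesis by (auto simp: vhom_def lincomb_def sum_fun_apply vscale_apply intro: deg_sum)
qed

lemma lincomb_irrelevant: "(\<And>e. v e \<in> \<mm>) \<Longrightarrow> lincomb vscale r \<phi> v i \<in> \<mm>"
  by (auto simp: lincomb_def sum_fun_apply vscale_apply intro!: irrelevant_sum irrelevant_mult_right)

text \<open>The vanishing of \<open>Tor_i\<close> in degree \<open>j\<close>, with cycles and
  boundaries of \<open>F\<close> tensored with \<open>k\<close> represented by vectors over the
  ring. The boundary \<open>w\<close> need not be homogeneous, so a homotopy need not preserve
  degrees.\<close>

definition tor_vanish :: "('r, 'm) free_cpx \<Rightarrow> nat \<Rightarrow> int \<Rightarrow> bool" where
  "tor_vanish F i j \<longleftrightarrow> (\<forall>v\<in>chain F i \<inter> vhom (shift F i) j. (\<forall>e. bd F i v e \<in> \<mm>) \<longrightarrow>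
     (\<exists>w\<in>chain F (Suc i). \<forall>e. (v - bd F (Suc i) w) e \<in> \<mm>))"

end

context fg_graded_module
begin

abbreviation resolution :: "('r, 'm) free_cpx \<Rightarrow> bool" where
  "resolution F \<equiv> graded_free_resolution A smul N F"

lemma resolution_exact:
  "resolution F \<Longrightarrow> syzygies smul F n = bd F (Suc n) ` chain F (Suc n)"
  by (cases "n = 0") (simp_all add: graded_free_resolution_def syzygies_def)

lemma resolution_bd_bd:
  assumes "resolution F" "v \<in> chain F (Suc n)"
  shows "bd F n (bd F (Suc n) v) = 0"
proof (cases n)
  case (Suc m)
  have "bd F (Suc n) v \<in> syzygies smul F n" using assms resolution_exact by blast
  then show ?thesis using Suc by (simp add: syzygies_def)
qed (simp add: bd_0)

lemma bd_cols_vhom: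
  assumes "resolution F" "e < rank F (Suc n)"
  shows "bd_cols F n e \<in> vhom (shift F n) (shift F (Suc n) e)"
  using assms deg_zero by (auto simp: graded_free_resolution_def bd_cols_def vhom_def)

lemma vcomp_bd:
  assumes "resolution F"
  shows "vcomp (shift F n) j (bd F (Suc n) v) = bd F (Suc n) (vcomp (shift F (Suc n)) j v)"
  unfolding bd_Suc_lincomb
  by (rule homogeneous_components.comp_lincomb[OF homogeneous_components_vec bd_cols_vhom[OF assms]])

lemma bd_unit_vec: "e < rank F (Suc n) \<Longrightarrow> bd F (Suc n) (unit_vec e) = bd_cols F n e"
  unfolding bd_Suc_lincomb by (rule vec.lincomb_unit_vec)

text \<open>The component of degree \<open>j\<close> of an arbitrary preimage is again a
  preimage.\<close>

lemma homogeneous_bd_preimage: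
  assumes F: "resolution F" and y: "y \<in> syzygies smul F n" "y \<in> vhom (shift F n) j"
  shows "\<exists>w\<in>chain F (Suc n) \<inter> vhom (shift F (Suc n)) j. bd F (Suc n) w = y"
proof -
  obtain w where w: "w \<in> chain F (Suc n)" "y = bd F (Suc n) w" using resolution_exact[OF F] y by blast
  have "bd F (Suc n) (vcomp (shift F (Suc n)) j w) = y"
    using vcomp_bd[OF F, of n j w] vcomp_of_vhom[OF y(2), of j] w(2) by simp
  then show ?thesis using w(1) vcomp_mem_vhom vcomp_free_module unfolding chain_def by blast
qed

lemma homogeneous_aug_preimage:
  assumes F: "resolution F" and x: "x \<in> N j"
  shows "\<exists>w\<in>chain F 0 \<inter> vhom (shift F 0) j. aug_map smul F w = x"
proof -
  interpret M: homogeneous_components \<kappa> A smul N "\<lambda>j x. hcomp N x j"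
    by (rule homogeneous_components_module)
  have "aug_map smul F ` chain F 0 = UNIV" and aug: "e < rank F 0 \<Longrightarrow> aug F e \<in> N (shift F 0 e)" for e
    using F by (auto simp: graded_free_resolution_def)
  then obtain w where w: "w \<in> chain F 0" "x = aug_map smul F w" by blast
  have "aug_map smul F (vcomp (shift F 0) j w) = x"
    using M.comp_lincomb[where r = "rank F 0" and j = j and v = w, OF aug] hcomp_of_mem[OF module_grading x, of j] w(2)
    by (simp add: aug_map_lincomb)
  then show ?thesis using w(1) vcomp_mem_vhom vcomp_free_module unfolding chain_def by blast
qed

text \<open>The identity of \<open>M\<close> is lifted degree by degree. Homogeneous preimages are
  chosen so that the chain map preserves the internal degree, which \<open>tor_vanish\<close>
  fixes.\<close>

lemma chain_map_exists:
  assumes F: "resolution F" and G: "resolution G"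
  shows "\<exists>\<phi>. (\<forall>n. \<forall>e<rank F n. \<phi> n e \<in> chain G n \<inter> vhom (shift G n) (shift F n e)) \<and>
    (\<forall>v. aug_map smul G (lincomb vscale (rank F 0) (\<phi> 0) v) = aug_map smul F v) \<and>
    (\<forall>n v. bd G (Suc n) (lincomb vscale (rank F (Suc n)) (\<phi> (Suc n)) v) =
      lincomb vscale (rank F n) (\<phi> n) (bd F (Suc n) v))"
proof -
  \<comment> \<open>That syzygies go to syzygies is the invariant which, by exactness of
    \<open>G\<close>, supplies the preimages for the next stage.\<close>
  define P where "P n \<phi> \<longleftrightarrow>
      (\<forall>e<rank F n. \<phi> e \<in> chain G n \<inter> vhom (shift G n) (shift F n e)) \<and>
      (\<forall>v\<in>syzygies smul F n. lincomb vscale (rank F n) \<phi> v \<in> syzygies smul G n) \<and>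
      (n = 0 \<longrightarrow> (\<forall>v. aug_map smul G (lincomb vscale (rank F 0) \<phi> v) = aug_map smul F v))" for n \<phi>
  define Q where "Q n \<phi> \<phi>' \<longleftrightarrow> (\<forall>v. bd G (Suc n) (lincomb vscale (rank F (Suc n)) \<phi>' v) =
      lincomb vscale (rank F n) \<phi> (bd F (Suc n) v))" for n \<phi> \<phi>'
  have lincomb_chain: "lincomb vscale (rank F n) \<phi> v \<in> chain G n"
    if "\<And>e. e < rank F n \<Longrightarrow> \<phi> e \<in> chain G n" for n \<phi> v
    unfolding chain_def by (rule vec.lincomb_mem[OF subspace_free_module that[unfolded chain_def]])
  have "\<exists>\<phi>. \<forall>n. P n (\<phi> n) \<and> Q n (\<phi> n) (\<phi> (Suc n))"
  proof (rule dependent_nat_choice)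
    have "\<exists>w\<in>chain G 0 \<inter> vhom (shift G 0) (shift F 0 e). aug_map smul G w = aug F e"
      if "e < rank F 0" for e
      by (rule homogeneous_aug_preimage[OF G]) (use F that in \<open>simp add: graded_free_resolution_def\<close>)
    then obtain \<phi> where \<phi>: "\<And>e. e < rank F 0 \<Longrightarrow> \<phi> e \<in> chain G 0 \<inter> vhom (shift G 0) (shift F 0 e)"
      "\<And>e. e < rank F 0 \<Longrightarrow> aug_map smul G (\<phi> e) = aug F e" by metis
    have aug: "aug_map smul G (lincomb vscale (rank F 0) \<phi> v) = aug_map smul F v" for v
      unfolding aug_map_lincomb lincomb_lincomb
      by (rule lincomb_cong) (use \<phi>(2) in \<open>simp add: aug_map_lincomb\<close>)
    have "P 0 \<phi>"
      unfolding P_def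
    proof (intro conjI allI impI ballI)
      fix v assume v: "v \<in> syzygies smul F 0"
      have "lincomb vscale (rank F 0) \<phi> v \<in> chain G 0" using \<phi>(1) by (intro lincomb_chain) blast
      then show "lincomb vscale (rank F 0) \<phi> v \<in> syzygies smul G 0"
        using v by (simp add: syzygies_def aug)
    qed (use \<phi>(1) aug in blast)+
    show "\<exists>\<phi>. P 0 \<phi>" by (rule exI[of "P 0" \<phi>]) fact
  next
    fix \<phi> n assume P: "P n \<phi>"
    have "\<exists>w\<in>chain G (Suc n) \<inter> vhom (shift G (Suc n)) (shift F (Suc n) e).
        bd G (Suc n) w = lincomb vscale (rank F n) \<phi> (bd_cols F n e)"
      if e: "e < rank F (Suc n)" for e
    proof (rule homogeneous_bd_preimage[OF G])
      have "bd_cols F n e \<in> syzygies smul F n"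
        unfolding resolution_exact[OF F] bd_unit_vec[OF e, symmetric] chain_def
        using unit_vec_mem[OF e] by (rule imageI)
      then show "lincomb vscale (rank F n) \<phi> (bd_cols F n e) \<in> syzygies smul G n"
        using P by (simp add: P_def)
      show "lincomb vscale (rank F n) \<phi> (bd_cols F n e) \<in> vhom (shift G n) (shift F (Suc n) e)"
        by (rule lincomb_vhom[OF _ bd_cols_vhom[OF F e]]) (use P in \<open>simp add: P_def\<close>)
    qed
    then obtain \<phi>' where \<phi>': "\<And>e. e < rank F (Suc n) \<Longrightarrow>
        \<phi>' e \<in> chain G (Suc n) \<inter> vhom (shift G (Suc n)) (shift F (Suc n) e)"
      "\<And>e. e < rank F (Suc n) \<Longrightarrow>
        bd G (Suc n) (\<phi>' e) = lincomb vscale (rank F n) \<phi> (bd_cols F n e)" by metis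
    have Q: "Q n \<phi> \<phi>'"
      unfolding Q_def bd_lincomb unfolding bd_Suc_lincomb[of F] vec.lincomb_lincomb
      using \<phi>'(2) by (intro allI vec.lincomb_cong)
    have "P (Suc n) \<phi>'"
      unfolding P_def
    proof (intro conjI allI impI ballI)
      fix v assume v: "v \<in> syzygies smul F (Suc n)"
      have "lincomb vscale (rank F (Suc n)) \<phi>' v \<in> chain G (Suc n)"
        using \<phi>'(1) by (intro lincomb_chain) blast
      moreover have "bd F (Suc n) v = 0" using v by (simp only: syzygies_def) simp
      then have "bd G (Suc n) (lincomb vscale (rank F (Suc n)) \<phi>' v) = 0"
        using Q unfolding Q_def by (metis vec.lincomb_zero)
      ultimately show "lincomb vscale (rank F (Suc n)) \<phi>' v \<in> syzygies smul G (Suc n)"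
        by (simp only: syzygies_def) simp
    qed (use \<phi>'(1) in simp_all)
    then show "\<exists>\<phi>'. P (Suc n) \<phi>' \<and> Q n \<phi> \<phi>'" using Q by blast
  qed
  then obtain \<phi> where "\<And>n. P n (\<phi> n)" "\<And>n. Q n (\<phi> n) (\<phi> (Suc n))" by blast
  then show ?thesis unfolding P_def Q_def by blast
qed

text \<open>For a chain endomorphism \<open>u\<close> over the zero map of \<open>M\<close>, the
  conclusion is the homotopy formula with one half left implicit: by exactness, being a syzygy means
  being a boundary. At \<open>n = 0\<close> the term with \<open>n - 1\<close> vanishes, since
  \<open>bd F 0\<close> is zero.\<close>

lemma contracting_homotopy_exists:
  assumes F: "resolution F"
    and lin: "\<And>n r \<psi> v. u n (lincomb vscale r \<psi> v) = lincomb vscale r (\<lambda>e. u n (\<psi> e)) v"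
    and chain: "\<And>n v. v \<in> chain F n \<Longrightarrow> u n v \<in> chain F n"
    and aug: "\<And>v. aug_map smul F (u 0 v) = 0"
    and bd: "\<And>n v. bd F (Suc n) (u (Suc n) v) = u n (bd F (Suc n) v)"
  shows "\<exists>\<psi>. \<forall>v\<in>chain F n.
    u n v - lincomb vscale (rank F (n - 1)) \<psi> (bd F n v) \<in> syzygies smul F n"
proof (induction n)
  case 0
  show ?case unfolding bd_0 using chain aug by (auto simp: syzygies_def)
next
  case (Suc n)
  then obtain \<psi> where \<psi>: "\<And>v. v \<in> chain F n \<Longrightarrow>
    u n v - lincomb vscale (rank F (n - 1)) \<psi> (bd F n v) \<in> syzygies smul F n" by blast
  \<comment> \<open>The induction hypothesis on basis vectors, with exactness, yields the columns
    \<open>w\<close> of the next homotopy.\<close>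
  have "\<exists>w\<in>chain F (Suc n). bd F (Suc n) w =
      u n (unit_vec e) - lincomb vscale (rank F (n - 1)) \<psi> (bd F n (unit_vec e))"
    if "e < rank F n" for e
    using \<psi>[of "unit_vec e"] unit_vec_mem[OF that] unfolding resolution_exact[OF F] chain_def
    by (metis imageE)
  then obtain w where w: "\<And>e. e < rank F n \<Longrightarrow> w e \<in> chain F (Suc n)"
    "\<And>e. e < rank F n \<Longrightarrow> bd F (Suc n) (w e) =
      u n (unit_vec e) - lincomb vscale (rank F (n - 1)) \<psi> (bd F n (unit_vec e))" by metis
  have "u (Suc n) v - lincomb vscale (rank F n) w (bd F (Suc n) v) \<in> syzygies smul F (Suc n)"
    if v: "v \<in> chain F (Suc n)" for v
  proof -
    define b where "b = bd F (Suc n) v"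
    have b: "lincomb vscale (rank F n) unit_vec b = b"
      by (rule lincomb_unit_vecs) (use bd_mem_chain[of F "Suc n" v] in \<open>simp only: b_def chain_def diff_Suc_1\<close>)
    have "bd F (Suc n) (lincomb vscale (rank F n) w b) = lincomb vscale (rank F n)
        (\<lambda>e. u n (unit_vec e) - lincomb vscale (rank F (n - 1)) \<psi> (bd F n (unit_vec e))) b"
      unfolding bd_lincomb by (rule vec.lincomb_cong[OF w(2)])
    also have "\<dots> = u n b - lincomb vscale (rank F (n - 1)) \<psi> (bd F n b)"
      unfolding vec.lincomb_cols_diff lin[symmetric] vec.lincomb_lincomb[symmetric]
        bd_lincomb[symmetric] b ..
    \<comment> \<open>On a boundary \<open>b\<close> the old homotopy contributes nothing, so the
      new one maps \<open>b\<close> to a preimage of \<open>u n b\<close>.\<close>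
    also have "bd F n b = 0" unfolding b_def by (rule resolution_bd_bd[OF F v])
    finally have "bd F (Suc n) (u (Suc n) v - lincomb vscale (rank F n) w b) = 0"
      unfolding bd_diff bd b_def by (simp only: vec.lincomb_zero diff_0_right diff_self)
    moreover have "u (Suc n) v - lincomb vscale (rank F n) w b \<in> chain F (Suc n)"
      using chain[OF v] w(1) unfolding chain_def
      by (intro vec.subspace_diff vec.lincomb_mem subspace_free_module)
    ultimately show ?thesis unfolding b_def by (simp only: syzygies_def) simp
  qed
  then show ?case by (intro exI[of _ w] ballI) (simp only: diff_Suc_1)
qed

text \<open>If \<open>f: F \<rightarrow> G\<close> and \<open>g: G \<rightarrow> F\<close> lift the identity of \<open>M\<close>, then \<open>id - g f\<close> is null-homotopic.\<close>

lemma tor_vanish_transfer: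
  assumes F: "resolution F" and G: "resolution G" and vanish: "tor_vanish G i j"
  shows "tor_vanish F i j"
proof -
  obtain \<phi> where \<phi>: "\<And>n e. e < rank F n \<Longrightarrow> \<phi> n e \<in> chain G n \<inter> vhom (shift G n) (shift F n e)"
    "\<And>v. aug_map smul G (lincomb vscale (rank F 0) (\<phi> 0) v) = aug_map smul F v"
    "\<And>n v. bd G (Suc n) (lincomb vscale (rank F (Suc n)) (\<phi> (Suc n)) v) =
      lincomb vscale (rank F n) (\<phi> n) (bd F (Suc n) v)"
    using chain_map_exists[OF F G] by metis
  obtain \<gamma> where \<gamma>: "\<And>n e. e < rank G n \<Longrightarrow> \<gamma> n e \<in> chain F n \<inter> vhom (shift F n) (shift G n e)"
    "\<And>v. aug_map smul F (lincomb vscale (rank G 0) (\<gamma> 0) v) = aug_map smul G v"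
    "\<And>n v. bd F (Suc n) (lincomb vscale (rank G (Suc n)) (\<gamma> (Suc n)) v) =
      lincomb vscale (rank G n) (\<gamma> n) (bd G (Suc n) v)"
    using chain_map_exists[OF G F] by metis
  define f where "f n = lincomb vscale (rank F n) (\<phi> n)" for n
  define g where "g n = lincomb vscale (rank G n) (\<gamma> n)" for n
  define u where "u n v = v - g n (f n v)" for n v
  have f_chain: "f n v \<in> chain G n" for n v
    unfolding f_def chain_def by (rule vec.lincomb_mem[OF subspace_free_module]) (use \<phi>(1) in \<open>auto simp: chain_def\<close>)
  have g_chain: "g n v \<in> chain F n" for n v
    unfolding g_def chain_def by (rule vec.lincomb_mem[OF subspace_free_module]) (use \<gamma>(1) in \<open>auto simp: chain_def\<close>)
  have "\<exists>\<psi>. \<forall>v\<in>chain F i. u i v - lincomb vscale (rank F (i - 1)) \<psi> (bd F i v) \<in> syzygies smul F i"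
  proof (rule contracting_homotopy_exists[OF F])
    show "u n (lincomb vscale r \<psi> v) = lincomb vscale r (\<lambda>e. u n (\<psi> e)) v" for n r \<psi> v
      unfolding u_def vec.lincomb_cols_diff f_def g_def vec.lincomb_lincomb ..
    show "u n v \<in> chain F n" if "v \<in> chain F n" for n v
      using that g_chain unfolding u_def chain_def by (intro vec.subspace_diff subspace_free_module)
    show "aug_map smul F (u 0 v) = 0" for v
      unfolding u_def using \<phi>(2) \<gamma>(2) by (simp add: aug_map_lincomb lincomb_diff f_def g_def)
    show "bd F (Suc n) (u (Suc n) v) = u n (bd F (Suc n) v)" for n v
      unfolding u_def bd_diff f_def g_def \<gamma>(3) \<phi>(3) ..
  qed
  then obtain \<psi> where \<psi>: "\<And>v. v \<in> chain F i \<Longrightarrow>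
    u i v - lincomb vscale (rank F (i - 1)) \<psi> (bd F i v) \<in> bd F (Suc i) ` chain F (Suc i)"
    unfolding resolution_exact[OF F] by blast
  show ?thesis
    unfolding tor_vanish_def
  proof (intro ballI impI)
    fix v assume v: "v \<in> chain F i \<inter> vhom (shift F i) j" and bd_v: "\<forall>e. bd F i v e \<in> \<mm>"
    have "f i v \<in> vhom (shift G i) j"
      unfolding f_def by (rule lincomb_vhom[of _ _ _ "shift F i"]) (use v \<phi>(1) in auto)
    moreover have "bd G i (f i v) e \<in> \<mm>" for e
    proof (cases i)
      case 0
      then show ?thesis using irrelevant_0 by (simp add: bd_0 zero_fun_apply)
    next
      case (Suc k)
      show ?thesis
        unfolding f_def Suc \<phi>(3) by (rule lincomb_irrelevant) (use bd_v Suc in simp)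
    qed
    ultimately obtain w where w: "w \<in> chain G (Suc i)" "\<And>e. (f i v - bd G (Suc i) w) e \<in> \<mm>"
      using vanish f_chain unfolding tor_vanish_def by blast
    define z where "z = f i v - bd G (Suc i) w"
    obtain x where x: "x \<in> chain F (Suc i)"
      "u i v - lincomb vscale (rank F (i - 1)) \<psi> (bd F i v) = bd F (Suc i) x" using \<psi>[of v] v by blast
    \<comment> \<open>Expanding \<open>v = u i v + g i (f i v)\<close> gives a boundary,
      \<open>g i z\<close> and the homotopy term. The last two have entries in \<open>\<mm>\<close>,
      since \<open>z\<close> and \<open>bd F i v\<close> do and linear maps keep this
      property.\<close>
    have "g i (f i v) = bd F (Suc i) (g (Suc i) w) + g i z"
      unfolding z_def g_def vec.lincomb_diff \<gamma>(3) by simp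
    then have "v = bd F (Suc i) (g (Suc i) w + x) + (g i z + lincomb vscale (rank F (i - 1)) \<psi> (bd F i v))"
      using x(2) unfolding u_def bd_add by (simp only: diff_eq_eq) (simp only: ac_simps)
    then have "v - bd F (Suc i) (g (Suc i) w + x) = g i z + lincomb vscale (rank F (i - 1)) \<psi> (bd F i v)"
      by (simp only: diff_eq_eq) (simp only: ac_simps)
    moreover have "(g i z + lincomb vscale (rank F (i - 1)) \<psi> (bd F i v)) e \<in> \<mm>" for e
      unfolding plus_fun_apply g_def
      using w(2) bd_v by (intro irrelevant_add lincomb_irrelevant) (auto simp: z_def)
    moreover have "g (Suc i) w + x \<in> chain F (Suc i)"
      using x(1) g_chain unfolding chain_def by (intro vec.subspace_add subspace_free_module)
    ultimately show "\<exists>w\<in>chain F (Suc i). \<forall>e. (v - bd F (Suc i) w) e \<in> \<mm>" by metis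
  qed
qed

end

section \<open>Betti numbers and the linear part\<close>

text \<open>Subtraction is truncated, so the left side says \<open>dim T \<le> dim S\<close>;
  extending a basis of \<open>S\<close> to one of \<open>T\<close> then adds nothing.\<close>

lemma (in vector_space) dim_diff_eq_0_iff:
  assumes "subspace S" "S \<subseteq> T" "finite E" "T \<subseteq> span E"
  shows "dim T - dim S = 0 \<longleftrightarrow> T \<subseteq> S"
proof
  assume le: "dim T - dim S = 0"
  obtain B where B: "B \<subseteq> S" "independent B" "S \<subseteq> span B" "card B = dim S"
    using basis_exists[of S] by blast
  obtain C where C: "B \<subseteq> C" "C \<subseteq> T" "independent C" "T \<subseteq> span C"
    using maximal_independent_subset_extend[of B T] B assms(2) by blast
  have "C \<subseteq> span E" using C(2) assms(4) by (rule subset_trans)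
  then have "finite C" using independent_span_bound[OF assms(3) C(3)] by blast
  moreover have "card C \<le> card B" using basis_card_eq_dim[OF C(2,4,3)] B(4) le by simp
  ultimately have "B = C" using C(1) card_seteq by blast
  then have "T \<subseteq> span B" using C(4) by simp
  also have "span B \<subseteq> S" using B(1) assms(1) by (rule span_minimal)
  finally show "T \<subseteq> S" .
qed (use assms(2) in \<open>simp add: subset_antisym\<close>)

context standard_graded_algebra
begin

abbreviation residue_vec :: "(nat \<Rightarrow> 'r) \<Rightarrow> nat \<Rightarrow> 'k" where
  "residue_vec v \<equiv> (\<lambda>e. residue \<kappa> A (v e))"

lemma residue_0: "residue \<kappa> A 0 = 0"
  by (simp add: residue_eq_0_iff irrelevant_0)

lemma residue_vec_mem:
  assumes "v \<in> chain F i" "v \<in> vhom (shift F i) j"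
  shows "residue_vec v \<in> tensor_chain F i j"
  unfolding tensor_chain_def
proof (intro CollectI allI impI)
  fix e assume "residue \<kappa> A (v e) \<noteq> 0"
  then have "v e \<noteq> 0" "v e \<notin> \<mm>" by (auto simp: residue_eq_0_iff irrelevant_0)
  moreover have "v e \<in> D (j - shift F i e)" using assms(2) by (simp add: vhom_def)
  ultimately show "e < rank F i \<and> shift F i e = j"
    using assms(1) irrelevant_of_degree by (force simp: chain_def free_module_def)
qed

text \<open>Applying \<kappa> entrywise is a section of \<open>residue_vec\<close> that respects
  degrees; classes over \<open>k\<close> are lifted to \<open>F\<close> in this way.\<close>

lemma kappa_vec_mem:
  assumes "w \<in> tensor_chain F i j"
  shows "(\<lambda>e. \<kappa> (w e)) \<in> chain F i \<inter> vhom (shift F i) j"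
proof -
  have "\<kappa> (w e) \<in> D (j - shift F i e)" for e
    using assms kappa_degree[of "w e"] kappa_0 deg_zero by (cases "w e = 0") (auto simp: tensor_chain_def)
  moreover have "\<kappa> (w e) = 0" if "rank F i \<le> e" for e
    using assms that unfolding tensor_chain_def kappa_eq_0_iff by (auto simp: not_le[symmetric])
  ultimately show ?thesis by (simp add: vhom_def chain_def free_module_def)
qed

lemma tensor_bd_residue_vec: "tensor_bd \<kappa> A F n (residue_vec v) = residue_vec (bd F n v)"
  by (cases n) (auto simp: fun_eq_iff residue_0 residue_sum residue_mult bd.simps)

end

context fg_graded_module
begin

lemma bd_vhom:
  assumes "resolution F" "v \<in> vhom (shift F n) j"
  shows "bd F n v \<in> vhom (shift F (n - 1)) j"
proof (cases n)
  case 0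
  show ?thesis unfolding 0 bd_0 using deg_zero by (simp add: vhom_def zero_fun_apply)
next
  case (Suc k)
  show ?thesis
    unfolding Suc bd_Suc_lincomb diff_Suc_1
    by (rule lincomb_vhom[OF bd_cols_vhom[OF assms(1)]]) (use assms(2) Suc in auto)
qed

text \<open>Lifted to the ring, this is the vanishing of two successive differentials of
  \<open>F\<close>.\<close>

lemma tor_boundaries_subset_cycles:
  assumes F: "resolution F"
  shows "tor_boundaries \<kappa> A F i j \<subseteq> tor_cycles \<kappa> A F i j"
proof
  fix v assume "v \<in> tor_boundaries \<kappa> A F i j"
  then obtain w where w: "w \<in> tensor_chain F (Suc i) j" "v = tensor_bd \<kappa> A F (Suc i) w"
    unfolding tor_boundaries_def by blast
  define x where "x = (\<lambda>e. \<kappa> (w e))"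
  have x: "x \<in> chain F (Suc i)" "x \<in> vhom (shift F (Suc i)) j" "w = residue_vec x"
    using kappa_vec_mem[OF w(1)] by (auto simp: x_def residue_kappa)
  have v: "v = residue_vec (bd F (Suc i) x)" unfolding w(2) x(3) by (rule tensor_bd_residue_vec)
  have "v \<in> tensor_chain F i j"
    unfolding v using bd_mem_chain[of F "Suc i" x] bd_vhom[OF F x(2)] by (intro residue_vec_mem) simp_all
  moreover have "tensor_bd \<kappa> A F i v = 0"
    unfolding v tensor_bd_residue_vec resolution_bd_bd[OF F x(1)]
    by (simp add: fun_eq_iff zero_fun_apply residue_0)
  ultimately show "v \<in> tor_cycles \<kappa> A F i j" by (simp add: tor_cycles_def)
qed

lemma tor_vanish_iff:
  assumes F: "resolution F"
  shows "tor_vanish F i j \<longleftrightarrow> tor_cycles \<kappa> A F i j \<subseteq> tor_boundaries \<kappa> A F i j"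
proof
  assume vanish: "tor_vanish F i j"
  show "tor_cycles \<kappa> A F i j \<subseteq> tor_boundaries \<kappa> A F i j"
  proof
    fix w assume w: "w \<in> tor_cycles \<kappa> A F i j"
    define v where "v = (\<lambda>e. \<kappa> (w e))"
    have v: "v \<in> chain F i \<inter> vhom (shift F i) j" and w_eq: "w = residue_vec v"
      using w kappa_vec_mem[of w F i j] by (auto simp: v_def tor_cycles_def residue_kappa)
    have "residue_vec (bd F i v) = 0"
      using w unfolding tor_cycles_def w_eq mem_Collect_eq tensor_bd_residue_vec by (rule conjunct2)
    then have "residue \<kappa> A (bd F i v e) = 0" for e by (simp add: fun_eq_iff zero_fun_apply)
    then obtain u where u: "\<And>e. (v - bd F (Suc i) u) e \<in> \<mm>"
      using vanish v unfolding tor_vanish_def residue_eq_0_iff by blast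
    \<comment> \<open>The witness \<open>u\<close> need not be homogeneous, but only basis elements
      of degree \<open>j\<close> are kept: by \<open>deg\<close>, an entry with nonzero residue
      joins basis elements of equal degree, so rows of degree \<open>j\<close> are unchanged and all
      others become zero, like those of \<open>w\<close>.\<close>
    define u' where "u' e = (if e < rank F (Suc i) \<and> shift F (Suc i) e = j then residue_vec u e else 0)" for e
    have w_res: "w e = tensor_bd \<kappa> A F (Suc i) (residue_vec u) e" for e
      using u[of e] unfolding tensor_bd_residue_vec w_eq
      by (simp add: minus_fun_apply residue_diff flip: residue_eq_0_iff)
    have deg: "residue \<kappa> A (mat F i l e) = 0"
      if "l < rank F i" "e < rank F (Suc i)" "shift F (Suc i) e \<noteq> shift F i l" for l e
      using that F irrelevant_of_degree[of "mat F i l e" "shift F (Suc i) e - shift F i l"]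
      unfolding residue_eq_0_iff by (simp add: graded_free_resolution_def)
    have "tensor_bd \<kappa> A F (Suc i) u' l = w l" for l
    proof (cases "l < rank F i \<and> shift F i l = j")
      case True
      then show ?thesis unfolding w_res using deg
        by (auto simp: u'_def intro!: sum.cong)
    next
      case False
      then have "tensor_bd \<kappa> A F (Suc i) u' l = 0"
        using deg by (auto simp: u'_def intro!: sum.neutral)
      then show ?thesis using False w by (auto simp: tor_cycles_def tensor_chain_def)
    qed
    moreover have "u' \<in> tensor_chain F (Suc i) j" by (auto simp: tensor_chain_def u'_def)
    ultimately show "w \<in> tor_boundaries \<kappa> A F i j"
      unfolding tor_boundaries_def by (intro image_eqI[of _ _ u']) auto
  qed
next
  assume sub: "tor_cycles \<kappa> A F i j \<subseteq> tor_boundaries \<kappa> A F i j"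
  show "tor_vanish F i j"
    unfolding tor_vanish_def
  proof (intro ballI impI)
    fix v assume v: "v \<in> chain F i \<inter> vhom (shift F i) j" and m: "\<forall>e. bd F i v e \<in> \<mm>"
    have "residue_vec v \<in> tor_cycles \<kappa> A F i j"
      unfolding tor_cycles_def mem_Collect_eq tensor_bd_residue_vec
      using v m residue_vec_mem by (auto simp: residue_eq_0_iff zero_fun_apply fun_eq_iff)
    then obtain w where w: "w \<in> tensor_chain F (Suc i) j"
      "residue_vec v = tensor_bd \<kappa> A F (Suc i) w" using sub unfolding tor_boundaries_def by blast
    define x where "x = (\<lambda>e. \<kappa> (w e))"
    have x: "x \<in> chain F (Suc i)" "w = residue_vec x"
      using kappa_vec_mem[OF w(1)] by (auto simp: x_def residue_kappa)
    have "residue_vec v = residue_vec (bd F (Suc i) x)"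
      unfolding w(2) unfolding x(2) by (rule tensor_bd_residue_vec)
    then have "(v - bd F (Suc i) x) e \<in> \<mm>" for e
      by (simp add: minus_fun_apply residue_diff fun_eq_iff flip: residue_eq_0_iff)
    then show "\<exists>w\<in>chain F (Suc i). \<forall>e. (v - bd F (Suc i) w) e \<in> \<mm>" using x(1) by blast
  qed
qed

text \<open>The resolution chosen inside \<open>betti\<close> is unknown; transferring
  \<open>tor_vanish\<close> in both directions replaces it by any given one.\<close>

lemma betti_eq_0_iff:
  assumes "resolution F"
  shows "betti \<kappa> A smul N i j = 0 \<longleftrightarrow> tor_vanish F i j"
proof -
  define G where "G = (SOME G. graded_free_resolution A smul N G)"
  have G: "resolution G" unfolding G_def using assms by (rule someI)
  interpret V: vector_space "\<lambda>(c::'k) (v :: nat \<Rightarrow> 'k) e. c * v e"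
    by unfold_locales (auto simp: fun_eq_iff plus_fun_apply algebra_simps)
  let ?B = "tor_boundaries \<kappa> A G i j"
  have "V.subspace ?B"
    unfolding V.subspace_def tor_boundaries_def
  proof (intro conjI ballI allI)
    show "0 \<in> tensor_bd \<kappa> A G (Suc i) ` tensor_chain G (Suc i) j"
      by (rule image_eqI[of _ _ "\<lambda>e. 0"]) (auto simp: tensor_chain_def fun_eq_iff zero_fun_apply)
  next
    fix x y assume "x \<in> tensor_bd \<kappa> A G (Suc i) ` tensor_chain G (Suc i) j"
      "y \<in> tensor_bd \<kappa> A G (Suc i) ` tensor_chain G (Suc i) j"
    then obtain v w where "v \<in> tensor_chain G (Suc i) j" "w \<in> tensor_chain G (Suc i) j"
      "x = tensor_bd \<kappa> A G (Suc i) v" "y = tensor_bd \<kappa> A G (Suc i) w" by blast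
    then show "x + y \<in> tensor_bd \<kappa> A G (Suc i) ` tensor_chain G (Suc i) j"
      by (intro image_eqI[of _ _ "\<lambda>e. v e + w e"])
        (auto simp: tensor_chain_def fun_eq_iff plus_fun_apply distrib_left sum.distrib, force+)
  next
    fix c x assume "x \<in> tensor_bd \<kappa> A G (Suc i) ` tensor_chain G (Suc i) j"
    then obtain v where "v \<in> tensor_chain G (Suc i) j" "x = tensor_bd \<kappa> A G (Suc i) v" by blast
    then show "(\<lambda>e. c * x e) \<in> tensor_bd \<kappa> A G (Suc i) ` tensor_chain G (Suc i) j"
      by (intro image_eqI[of _ _ "\<lambda>e. c * v e"])
        (auto simp: tensor_chain_def fun_eq_iff sum_distrib_left mult.left_commute)
  qed
  moreover have "?B \<subseteq> tor_cycles \<kappa> A G i j" by (rule tor_boundaries_subset_cycles[OF G])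
  moreover have "tor_cycles \<kappa> A G i j \<subseteq> V.span (unit_vec ` {..<rank G i})"
  proof
    fix v assume "v \<in> tor_cycles \<kappa> A G i j"
    then have "v \<in> free_module (rank G i)"
      by (force simp: tor_cycles_def tensor_chain_def free_module_def)
    then have "v = (\<Sum>e<rank G i. (\<lambda>l. v e * unit_vec e l))"
      using lincomb_unit_vecs[of v "rank G i"] by (simp add: lincomb_def vscale_def)
    also have "\<dots> \<in> V.span (unit_vec ` {..<rank G i})"
      by (intro V.span_sum V.span_scale V.span_base) simp
    finally show "v \<in> V.span (unit_vec ` {..<rank G i})" .
  qed
  ultimately have "V.dim (tor_cycles \<kappa> A G i j) - V.dim ?B = 0 \<longleftrightarrow> tor_cycles \<kappa> A G i j \<subseteq> ?B"
    by (intro V.dim_diff_eq_0_iff[of _ _ "unit_vec ` {..<rank G i}"]) auto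
  then have "betti \<kappa> A smul N i j = 0 \<longleftrightarrow> tor_vanish G i j"
    unfolding tor_vanish_iff[OF G] unfolding betti_def Let_def G_def .
  then show ?thesis using tor_vanish_transfer[OF assms G] tor_vanish_transfer[OF G assms] by blast
qed

section \<open>Minimal resolutions and their linear parts\<close>

abbreviation minimal_resolution :: "('r, 'm) free_cpx \<Rightarrow> bool" where
  "minimal_resolution F \<equiv> minimal_graded_free_resolution A smul N F"

lemma minimal_bd_irrelevant:
  assumes "minimal_resolution F" "v \<in> chain F n"
  shows "bd F n v e \<in> \<mm>"
proof (cases n)
  case 0
  then show ?thesis by (simp add: bd_0 zero_fun_apply irrelevant_0)
next
  case (Suc k)
  have "bd F (Suc k) v \<in> ideal_times \<mm> (chain F k)"
    using assms Suc unfolding minimal_graded_free_resolution_def by blast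
  then show ?thesis
    unfolding chain_def ideal_times_free_module[OF ring_ideal_irrelevant] Suc by blast
qed

text \<open>All boundaries have entries in \<open>\<mm>\<close>. So a basis element of degree
  \<open>j\<close> is a cycle modulo \<open>\<mm>\<close> that no boundary matches, and without one
  every vector of degree \<open>j\<close> already has its entries in \<open>\<mm>\<close>.\<close>

lemma betti_minimal:
  assumes F: "minimal_resolution F"
  shows "betti \<kappa> A smul N i j \<noteq> 0 \<longleftrightarrow> (\<exists>e<rank F i. shift F i e = j)"
proof -
  have res: "resolution F" using F by (simp add: minimal_graded_free_resolution_def)
  have "tor_vanish F i j \<longleftrightarrow> \<not> (\<exists>e<rank F i. shift F i e = j)"
  proof
    assume vanish: "tor_vanish F i j"
    show "\<not> (\<exists>e<rank F i. shift F i e = j)"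
    proof
      assume "\<exists>e<rank F i. shift F i e = j"
      then obtain e where e: "e < rank F i" "shift F i e = j" by blast
      have "unit_vec e \<in> chain F i \<inter> vhom (shift F i) j"
        using unit_vec_mem[OF e(1)] e(2) one_degree deg_zero
        by (auto simp: chain_def vhom_def unit_vec_def)
      then obtain w where w: "w \<in> chain F (Suc i)" "(unit_vec e - bd F (Suc i) w) e \<in> \<mm>"
        using vanish minimal_bd_irrelevant[OF F] unfolding tor_vanish_def by blast
      from irrelevant_add[OF w(2) minimal_bd_irrelevant[OF F w(1), of e]] have "1 \<in> \<mm>"
        by (simp add: minus_fun_apply unit_vec_def)
      then show False using one_not_irrelevant by blast
    qed
  next
    assume none: "\<not> (\<exists>e<rank F i. shift F i e = j)"
    show "tor_vanish F i j"
      unfolding tor_vanish_def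
    proof (intro ballI impI)
      fix v assume v: "v \<in> chain F i \<inter> vhom (shift F i) j"
      have "v e \<in> \<mm>" for e
      proof (cases "e < rank F i")
        case True
        then have "j - shift F i e \<noteq> 0" using none by auto
        moreover have "v e \<in> D (j - shift F i e)" using v by (simp add: vhom_def)
        ultimately show ?thesis by (rule irrelevant_of_degree[rotated])
      qed (use v irrelevant_0 in \<open>simp add: chain_def free_module_def\<close>)
      moreover have "0 \<in> chain F (Suc i)" unfolding chain_def by (rule vec.subspace_0[OF subspace_free_module])
      ultimately show "\<exists>w\<in>chain F (Suc i). \<forall>e. (v - bd F (Suc i) w) e \<in> \<mm>"
        by (intro bexI[of _ 0]) (auto simp: bd_zero minus_fun_apply zero_fun_apply)
    qed
  qed
  then show ?thesis by (simp add: betti_eq_0_iff[OF res])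
qed

text \<open>Stated for single basis elements rather than for \<open>t_deg\<close>, so that it can be
  iterated on shifts; \<open>betti_minimal\<close> identifies these with the degrees of nonzero
  Betti numbers.\<close>

lemma linear_entry:
  assumes F: "minimal_resolution F" and lin: "lin_homology_zero A F (Suc n)" and e: "e < rank F (Suc n)"
  shows "\<exists>i<rank F n. shift F (Suc n) e = shift F n i + 1"
proof (rule ccontr)
  assume none: "\<not> ?thesis"
  have res: "resolution F" using F by (simp add: minimal_graded_free_resolution_def)
  \<comment> \<open>In component \<open>n + 1\<close> the term at \<open>n + 1\<close> is
    \<open>F_(n+1)\<close> modulo \<open>\<mm>\<close>, the term at \<open>n\<close> is
    \<open>\<mm> F_n\<close> modulo the square, and the term at \<open>n + 2\<close> is
    zero.\<close>
  let ?p = "Suc n" and ?I = "ideal_power \<mm> 2"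
  have filt: "filt A F p q = {v \<in> chain F q. \<forall>e. v e \<in> ideal_power \<mm> (p - q)}" for p q
    unfolding filt_def chain_def by (rule ideal_times_free_module[OF ring_ideal_power])
  have filt_p: "filt A F ?p (Suc n) = chain F (Suc n)"
    "filt A F (Suc ?p) (Suc n) = {v \<in> chain F (Suc n). \<forall>e. v e \<in> \<mm>}"
    "filt A F (Suc ?p) n = {v \<in> chain F n. \<forall>e. v e \<in> ?I}"
    unfolding filt using ideal_power_1 by (simp_all del: ideal_power.simps add: ideal_power.simps(1) Suc_diff_le flip: numeral_2_eq_2)
  have ring_I: "0 \<in> ?I" "x \<in> ?I \<Longrightarrow> y \<in> ?I \<Longrightarrow> x + y \<in> ?I" "x \<in> ?I \<Longrightarrow> a * x \<in> ?I" for x y a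
    using ring_ideal_power[of \<mm> 2] unfolding ring_ideal_iff by blast+
  have sub_I: "module.subspace (*) ?I" by (rule ring_ideal_power)
  have entry_m: "bd_cols F n k i \<in> \<mm>" if "k < rank F (Suc n)" for i k
    using minimal_bd_irrelevant[OF F, of "unit_vec k" "Suc n" i] unit_vec_mem[OF that]
    unfolding bd_unit_vec[OF that] chain_def by blast
  \<comment> \<open>Degree 1 is excluded by \<open>none\<close>. An entry of negative degree is
    zero, and so is one of degree 0, since minimality puts it in \<open>\<mm>\<close>.\<close>
  have entry: "bd_cols F n e i \<in> ?I" for i
  proof (cases "i < rank F n")
    case True
    let ?d = "shift F (Suc n) e - shift F n i"
    have deg: "bd_cols F n e i \<in> D ?d" using bd_cols_vhom[OF res e] by (simp add: vhom_def)
    consider "?d < 0" | "?d = 0" | "?d \<ge> 2" using none True by force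
    then show ?thesis
    proof cases
      case 1
      then show ?thesis using deg ring_I(1) by simp
    next
      case 2
      then have "hcomp D (bd_cols F n e i) 0 = bd_cols F n e i" using hc_of_mem[OF deg, of 0] by simp
      then show ?thesis using entry_m[OF e, of i] ring_I(1) by (simp add: mem_irrelevant_iff)
    qed (use degree_ge_2_mem deg in blast)
  qed (simp add: bd_cols_def ring_I)
  define C where "C = (\<lambda>u. unit_vec e + u) ` filt A F (Suc ?p) (Suc n)"
  have e_chain: "unit_vec e \<in> chain F (Suc n)" unfolding chain_def using e by (rule unit_vec_mem)
  then have C: "C \<in> lin_chain A F ?p (Suc n)" unfolding lin_chain_def filt_p(1) C_def by blast
  have bd_C: "bd F (Suc n) v \<in> filt A F (Suc ?p) n" if "v \<in> C" for v
  proof -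
    from that obtain u where u: "v = unit_vec e + u" "\<And>k. u k \<in> \<mm>" unfolding C_def filt_p by blast
    have "bd F (Suc n) u i \<in> ?I" for i
      unfolding bd_Suc_lincomb lincomb_def sum_fun_apply vscale_apply
      by (intro module.subspace_sum[OF module_self sub_I] mult_mem_ideal_power_2 u(2) entry_m) simp
    then have "bd F (Suc n) v i \<in> ?I" for i
      unfolding u(1) bd_add bd_unit_vec[OF e] plus_fun_apply by (intro ring_I(2) entry)
    moreover have "bd F (Suc n) v \<in> chain F n" using bd_mem_chain[of F "Suc n" v] by simp
    ultimately show ?thesis unfolding filt_p by blast
  qed
  have sub: "vec.subspace (filt A F (Suc ?p) n)"
    unfolding filt_def ideal_times_def by (rule vec.subspace_span)
  have e_C: "unit_vec e \<in> C"
    unfolding C_def filt_def ideal_times_def by (rule image_eqI[OF _ vec.span_zero]) simp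
  \<comment> \<open>The right side is the zero coset, so this says that the class \<open>C\<close>
    of the basis element is a cycle.\<close>
  have "lin_bd A F ?p (Suc n) C = filt A F (Suc ?p) n"
  proof
    show "lin_bd A F ?p (Suc n) C \<subseteq> filt A F (Suc ?p) n"
      unfolding lin_bd_def using bd_C vec.subspace_add[OF sub] by auto
    show "filt A F (Suc ?p) n \<subseteq> lin_bd A F ?p (Suc n) C"
    proof
      fix y assume y: "y \<in> filt A F (Suc ?p) n"
      have "y - bd F (Suc n) (unit_vec e) \<in> filt A F (Suc ?p) n"
        by (rule vec.subspace_diff[OF sub y bd_C[OF e_C]])
      moreover have "y = bd F (Suc n) (unit_vec e) + (y - bd F (Suc n) (unit_vec e))"
        by (rule trans[OF diff_add_cancel[symmetric] add.commute])
      ultimately show "y \<in> lin_bd A F ?p (Suc n) C" unfolding lin_bd_def diff_Suc_1 using e_C by blast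
    qed
  qed
  then have "C \<in> lin_bd A F ?p (Suc (Suc n)) ` lin_chain A F ?p (Suc (Suc n))"
    using C lin unfolding lin_homology_zero_def diff_Suc_1 by blast
  then obtain C' where C': "C' \<in> lin_chain A F ?p (Suc (Suc n))" "C = lin_bd A F ?p (Suc (Suc n)) C'"
    by blast
  have "C' \<subseteq> chain F (Suc (Suc n))"
    using C'(1) vec.subspace_add[OF subspace_free_module]
    unfolding lin_chain_def filt chain_def by blast
  \<comment> \<open>Being a boundary puts the basis element into the image of \<open>bd\<close> plus
    \<open>\<mm> F_(n+1)\<close>; minimality then forces its entry 1 into
    \<open>\<mm>\<close>.\<close>
  then obtain v u where "unit_vec e = bd F (Suc (Suc n)) v + u" "v \<in> chain F (Suc (Suc n))"
    "u \<in> filt A F (Suc ?p) (Suc n)"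
    using e_C unfolding C'(2) lin_bd_def by auto
  then have "unit_vec e e \<in> \<mm>"
    using minimal_bd_irrelevant[OF F] irrelevant_add unfolding filt_p by (simp add: plus_fun_apply)
  then show False using one_not_irrelevant by (simp add: unit_vec_def)
qed

text \<open>The hypothesis speaks of vanishing above \<open>d\<close> only, which serves a finite
  linearity defect and, with \<open>d = 0\<close>, the Koszul case.\<close>

lemma reg_eq_Max:
  assumes lin: "\<And>i. d < i \<Longrightarrow> lin_homology_zero A (min_res A smul N) i"
  shows "reg \<kappa> A smul N = Max ((\<lambda>i. t_deg \<kappa> A smul N i - ereal (real i)) ` {0..d})"
proof -
  define F where "F = min_res A smul N"
  have F: "minimal_resolution F"
    unfolding F_def min_res_def using minimal_graded_free_resolution_exists by (rule someI_ex)
  let ?T = "\<lambda>i. t_deg \<kappa> A smul N i - ereal (real i)"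
  let ?m = "Max (?T ` {0..d})"
  have bet: "ereal (real_of_int (j - int i)) \<le> ?T i" if "betti \<kappa> A smul N i j \<noteq> 0" for i j
  proof -
    have "ereal (real_of_int j) \<le> t_deg \<kappa> A smul N i" unfolding t_deg_def by (rule Sup_upper) (use that in blast)
    then have "ereal (real_of_int j) - ereal (real i) \<le> ?T i" by (rule ereal_minus_mono) simp
    then show ?thesis by simp
  qed
  \<comment> \<open>Each linear entry lowers the shift and the homological degree by one, so their
    difference survives the descent from \<open>d + k\<close> to \<open>d\<close>.\<close>
  have step: "\<exists>e<rank F d. shift F (d + k) i - int (d + k) = shift F d e - int d"
    if "i < rank F (d + k)" for k i
    using that
  proof (induction k arbitrary: i)
    case (Suc k)
    have "lin_homology_zero A F (Suc (d + k))" unfolding F_def by (rule lin) simp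
    from linear_entry[OF F this, of i] Suc.prems obtain l where
      "l < rank F (d + k)" "shift F (Suc (d + k)) i = shift F (d + k) l + 1" by auto
    then show ?case using Suc.IH[of l] by auto
  qed auto
  have "ereal (real_of_int (j - int i)) \<le> ?m" if b: "betti \<kappa> A smul N i j \<noteq> 0" for i j
  proof (cases "i \<le> d")
    case True
    have "?T i \<le> ?m" by (rule Max_ge) (use True in auto)
    then show ?thesis using bet[OF b] by (rule order_trans[rotated])
  next
    case False
    then obtain k where i: "i = d + k" using le_Suc_ex[of d i] by auto
    obtain e where "e < rank F i" "shift F i e = j" using b betti_minimal[OF F] by blast
    then obtain l where l: "l < rank F d" "j - int i = shift F d l - int d" using step i by blast
    then have "betti \<kappa> A smul N d (shift F d l) \<noteq> 0" using betti_minimal[OF F] by blast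
    from bet[OF this] have "ereal (real_of_int (j - int i)) \<le> ?T d" unfolding l(2) .
    also have "?T d \<le> ?m" by (rule Max_ge) auto
    finally show ?thesis .
  qed
  then have le: "reg \<kappa> A smul N \<le> ?m" unfolding reg_def by (intro Sup_least) auto
  have "?T i \<le> reg \<kappa> A smul N" for i
  proof -
    \<comment> \<open>The finite number \<open>i\<close> is moved to the right so that the bound can
      be checked on each element of the supremum, which may be over the empty set.\<close>
    have "t_deg \<kappa> A smul N i \<le> reg \<kappa> A smul N + ereal (real i)"
      unfolding t_deg_def
    proof (rule Sup_least)
      fix x assume "x \<in> {ereal (real_of_int j) | j. betti \<kappa> A smul N i j \<noteq> 0}"
      then obtain j where j: "x = ereal (real_of_int j)" "betti \<kappa> A smul N i j \<noteq> 0" by blast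
      have "ereal (real_of_int (j - int i)) \<le> reg \<kappa> A smul N"
        unfolding reg_def by (rule Sup_upper) (use j(2) in blast)
      then have "ereal (real_of_int (j - int i)) + ereal (real i) \<le> reg \<kappa> A smul N + ereal (real i)"
        by (rule add_right_mono)
      then show "x \<le> reg \<kappa> A smul N + ereal (real i)" by (simp add: j(1))
    qed
    then show ?thesis by (simp add: ereal_minus_le)
  qed
  then have "?m \<le> reg \<kappa> A smul N" by simp
  with le show ?thesis by (rule antisym)
qed

end

theorem proposition3p5:
  fixes \<kappa> :: "'k::field \<Rightarrow> 'r::comm_ring_1"
    and A :: "nat \<Rightarrow> 'r set"
    and smul :: "'r \<Rightarrow> 'm::ab_group_add \<Rightarrow> 'm"
    and N :: "int \<Rightarrow> 'm set"
  assumes "fg_graded_module \<kappa> A smul N"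
    and "\<exists>x::'m. x \<noteq> 0"
  shows "(\<forall>d::nat. linearity_defect A smul N = enat d \<longrightarrow>
            reg \<kappa> A smul N = Max ((\<lambda>i. t_deg \<kappa> A smul N i - ereal (real i)) ` {0..d})) \<and>
         (koszul A smul N \<longrightarrow> reg \<kappa> A smul N = t_deg \<kappa> A smul N 0)"
proof (intro conjI allI impI)
  interpret fg_graded_module \<kappa> A smul N by fact
  fix d assume ld: "linearity_defect A smul N = enat d"
  show "reg \<kappa> A smul N = Max ((\<lambda>i. t_deg \<kappa> A smul N i - ereal (real i)) ` {0..d})"
  proof (rule reg_eq_Max, rule ccontr)
    fix i assume "d < i" "\<not> lin_homology_zero A (min_res A smul N) i"
    then have "enat i \<le> linearity_defect A smul N"
      unfolding linearity_defect_def by (intro Sup_upper) blast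
    then show False using ld \<open>d < i\<close> by simp
  qed
next
  interpret fg_graded_module \<kappa> A smul N by fact
  assume "koszul A smul N"
  then have "reg \<kappa> A smul N = Max ((\<lambda>i. t_deg \<kappa> A smul N i - ereal (real i)) ` {0..0})"
    by (intro reg_eq_Max) (simp add: koszul_def)
  then show "reg \<kappa> A smul N = t_deg \<kappa> A smul N 0" by (simp add: zero_ereal_def[symmetric])
qed

end
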